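(* Let examples $((x_i,y_i))_{i=1}^n$ be given satisfying $|x_iy_i|\le 1$, along with a loss $\ell\in\{\ell_{\log},\ell_{\exp}\}$, with corresponding empirical risk $\mathcal R$. Consider the gradient descent iterates $(w_j)_{j\ge0}$ given by $w_0=0$ and $w_{j+1}=w_j-\eta_j\nabla\mathcal R(w_j)$ with step sizes $\eta_j$. 1. (Convergence in risk.) For any step sizes $\eta_j\le 1$ and any $t\ge 1$, $$\mathcal R(w_t)-\inf_{w\in\mathbb R^d}\mathcal R(w)=O\!\left(\frac1t+\frac{\ln(t)^2}{\sum_{j<t}\eta_j}\right)=\begin{cases}O(\ln(t)^2/t)&\text{if }\eta_j=\Omega(1),\\ O(\ln(t)^2/\sqrt t)&\text{if }\eta_j=\Omega(1/\sqrt{j+1}),\end{cases}$$ where $O(\cdot)$ hides problem-dependent constants. 2. (Convergence in parameters; implicit bias and regularization.) The data uniquely determines a subspace $S$ and a vector $\bar v\in S$ (described in the context), such that if $\eta_j:=1/\sqrt{j+1}$ and $t^2=\Omega(n\ln(t))$, letting $\Pi_S$ denote orthogonal projection onto $S$ and $\bar w_t:=\arg\min\{\mathcal R(w):|w|\le|w_t|\}$ denote the solution to the constrained optimization problem, then $$|\Pi_Sw_t|=\Theta(1)\qquad\text{and}\qquad\max\left\{|\Pi_Sw_t-\bar v|^2,\ |\Pi_S\bar w_t-\bar v|^2\right\}=O\!\left(\frac{\ln(t)^2}{\sqrt t}\right).$$ If there are examples outside $S$, their projection onto $S^\perp$ is linearly separable with maximum margin predictor $\bar u\in S^\perp$, and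 $$|\Pi_{S^\perp}w_t|=\Theta(\ln(t))\qquad\text{and}\qquad\max\left\{\left|\frac{w_t}{|w_t|}-\bar u\right|^2,\ \left|\frac{\bar w_t}{|\bar w_t|}-\bar u\right|^2\right\}=O\!\left(\frac{\ln\ln t}{\ln t}\right).$$ In particular, $w_t/|w_t|\to\bar u$ and $\Pi_Sw_t\to\bar v$.
   Context: $|\cdot|$ is the Euclidean norm. The data are $x_i\in\mathbb R^d$ with labels $y_i$, $i=1,\dots,n$. The losses are $\ell_{\exp}(z)=e^z$ and $\ell_{\log}(z)=\ln(1+e^z)$, and $\mathcal R(w)=\frac1n\sum_{i=1}^n\ell(\langle w,-x_iy_i\rangle)$. $\Pi_{S^\perp}$ is the orthogonal projection onto $S^\perp$. Let $A\in\mathbb R^{n\times d}$ have rows $A_i=-y_ix_i^\top$. Row $i$ is placed in the matrix $A_c$ if there is $u\in\mathbb R^d$ with $Au\le0$ coordinate-wise and $(Au)_i<0$; otherwise it is placed in $A_S$. $S$ is the linear span of the rows of $A_S$. The rows of $A_c$ are the examples outside $S$. For a vector $v$ of any dimension, $L(v)=\sum_i\ell(v_i)$. $\bar v$ is the unique minimizer over $v\in S$ of $L(A_Sv)$. If $A_c$ is nonempty, $A_\perp$ is the matrix whose rows are the orthogonal projections of the rows of $A_c$ onto $S^\perp$; linear separability means that there is $u$ with $A_\perp u<0$ coordinate-wise, and the maximum margin predictor $\bar u$ is the unique minimizer of $\max_i(A_\perp u)_i$ over unit vectors $u$.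
   Formalization: The lower bound in |Π_S w_t| = Θ(1) is claimed only when v̄ ≠ 0 (the upper bound always): if v̄ = 0, e.g. for linearly separable data where S = {0}, then Π_S w_t → 0 and no positive lower bound can hold. *)

theory Defs
  imports "HOL-Analysis.Analysis"
begin

definition ell_exp :: "real \<Rightarrow> real" where
  "ell_exp z = exp z"

definition ell_log :: "real \<Rightarrow> real" where
  "ell_log z = ln (1 + exp z)"

text \<open>A data set consists of \<open>n = CARD('n)\<close> examples \<open>x $ i\<close> in \<open>d\<close>-dimensional Euclidean space
  with labels \<open>y $ i\<close>.  Labels are arbitrary reals; only the products \<open>y $ i *\<^sub>R x $ i\<close> matter.\<close>

definition risk :: "(real \<Rightarrow> real) \<Rightarrow> real^'d^'n \<Rightarrow> real^'n \<Rightarrow> real^'d \<Rightarrow> real" where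
  "risk ell x y w = (1 / real CARD('n)) * (\<Sum>i\<in>UNIV. ell (w \<bullet> (- (y $ i *\<^sub>R x $ i))))"

definition gradient :: "('a::real_inner \<Rightarrow> real) \<Rightarrow> 'a \<Rightarrow> 'a" where
  "gradient f w = (THE D. GDERIV f w :> D)"

primrec gd_iter ::
  "(real \<Rightarrow> real) \<Rightarrow> real^'d^'n \<Rightarrow> real^'n \<Rightarrow> (nat \<Rightarrow> real) \<Rightarrow> nat \<Rightarrow> real^'d" where
  "gd_iter ell x y \<eta> 0 = 0"
| "gd_iter ell x y \<eta> (Suc j) =
     gd_iter ell x y \<eta> j - \<eta> j *\<^sub>R gradient (risk ell x y) (gd_iter ell x y \<eta> j)"

definition orth_proj :: "'a::euclidean_space set \<Rightarrow> 'a \<Rightarrow> 'a" where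
  "orth_proj S w = (THE p. p \<in> S \<and> w - p \<in> S\<^sup>\<bottom>)"

definition data_matrix :: "real^'d^'n \<Rightarrow> real^'n \<Rightarrow> real^'d^'n" where
  "data_matrix x y = (\<chi> i. - (y $ i *\<^sub>R x $ i))"

text \<open>A submatrix of rows is represented by the full matrix together with a set of row indices:
  \<open>idx_c\<close> gives the rows of \<open>A\<^sub>c\<close>, and its complement \<open>idx_S\<close> those of \<open>A\<^sub>S\<close>.\<close>

definition idx_c :: "real^'d^'n \<Rightarrow> real^'n \<Rightarrow> 'n set" where
  "idx_c x y = {i. \<exists>u. (\<forall>k. (data_matrix x y *v u) $ k \<le> 0) \<and> (data_matrix x y *v u) $ i < 0}"

definition idx_S :: "real^'d^'n \<Rightarrow> real^'n \<Rightarrow> 'n set" where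
  "idx_S x y = - idx_c x y"

definition S_space :: "real^'d^'n \<Rightarrow> real^'n \<Rightarrow> (real^'d) set" where
  "S_space x y = span ((\<lambda>i. row i (data_matrix x y)) ` idx_S x y)"

text \<open>\<open>total_loss ell I v\<close> is the loss \<open>L\<close> of the subvector of \<open>v\<close> with coordinates in \<open>I\<close>.\<close>

definition total_loss :: "(real \<Rightarrow> real) \<Rightarrow> 'n set \<Rightarrow> real^'n \<Rightarrow> real" where
  "total_loss ell I v = (\<Sum>i\<in>I. ell (v $ i))"

definition is_v_bar :: "(real \<Rightarrow> real) \<Rightarrow> real^'d^'n \<Rightarrow> real^'n \<Rightarrow> real^'d \<Rightarrow> bool" where
  "is_v_bar ell x y =
     is_arg_min (\<lambda>v. total_loss ell (idx_S x y) (data_matrix x y *v v)) (\<lambda>v. v \<in> S_space x y)"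

definition v_bar :: "(real \<Rightarrow> real) \<Rightarrow> real^'d^'n \<Rightarrow> real^'n \<Rightarrow> real^'d" where
  "v_bar ell x y = (THE v. is_v_bar ell x y v)"

text \<open>Only the rows of \<open>A_perp\<close> with index in \<open>idx_c\<close> belong to the projected matrix.\<close>

definition A_perp :: "real^'d^'n \<Rightarrow> real^'n \<Rightarrow> real^'d^'n" where
  "A_perp x y = (\<chi> i. orth_proj ((S_space x y)\<^sup>\<bottom>) (row i (data_matrix x y)))"

definition is_u_bar :: "real^'d^'n \<Rightarrow> real^'n \<Rightarrow> real^'d \<Rightarrow> bool" where
  "is_u_bar x y =
     is_arg_min (\<lambda>u. Max ((\<lambda>i. (A_perp x y *v u) $ i) ` idx_c x y)) (\<lambda>u. norm u = 1)"

definition u_bar :: "real^'d^'n \<Rightarrow> real^'n \<Rightarrow> real^'d" where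
  "u_bar x y = (THE u. is_u_bar x y u)"

text \<open>The constrained minimizer over a ball need not be unique when \<open>idx_c\<close> is empty,
  so it is treated as a predicate.\<close>

definition is_w_bar ::
  "(real \<Rightarrow> real) \<Rightarrow> real^'d^'n \<Rightarrow> real^'n \<Rightarrow> real \<Rightarrow> real^'d \<Rightarrow> bool" where
  "is_w_bar ell x y r = is_arg_min (risk ell x y) (\<lambda>w. norm w \<le> r)"

end

theory Submission
  imports Defs "HOL-Real_Asymp.Real_Asymp"
begin

text \<open>
  Write \<open>excess = R - inf R\<close>, and let \<open>\<gamma>\<close> be the margin of \<open>ubar\<close>. Three estimates drive everything.
  On \<open>S\<close> the risk is coercive and strongly convex on sublevel sets, so \<open>|\<Pi>\<^sub>S w - vbar|\<^sup>2 = O(excess w)\<close>.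
  Along the separating direction the excess decays exponentially: \<open>excess (vbar + s ubar) = O(exp (- \<gamma> s))\<close>.
  Conversely, since \<open>- \<gamma> ubar\<close> is a convex combination of the projected rows,
  \<open>exp (- \<gamma> \<langle>ubar, w\<rangle>) = O(excess w)\<close>.

  The risk bound is the standard telescoping argument for gradient descent with reference point
  \<open>vbar + ln t \<cdot> u\<close>. For the direction of the iterates, the distance from \<open>w\<^sub>t\<close> to the moving reference point
  \<open>z\<^sub>t = vbar + ln t / (2 \<gamma>) \<cdot> ubar\<close> is tracked: the risk bound gives
  \<open>\<langle>ubar, w\<^sub>t\<rangle> \<ge> ln t / (2 \<gamma>) - O(ln ln t)\<close>, so moving the reference point costs only \<open>O(ln t \<cdot> ln ln t)\<close> in total,
  which is \<open>|w\<^sub>t - z\<^sub>t|\<^sup>2 = O(ln t \<cdot> ln ln t)\<close>. The constrained optimum is compared with the point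
  \<open>vbar + (r - |vbar|) ubar\<close> of the ball of radius \<open>r\<close>.
\<close>

section \<open>Loss functions\<close>

text \<open>The third-order Taylor remainder gives the coefficient 1/2 + e/6, which lies below
  24/25. What matters is that 24/25 is below 1: the slack 1/25 is the decrease that survives in
  \<open>descent\<close>.\<close>

lemma exp_quadratic_bound:
  fixes h :: real
  assumes "\<bar>h\<bar> \<le> 1"
  shows "exp h - 1 \<le> h + 24 / 25 * h\<^sup>2"
proof -
  obtain t where t: "\<bar>t\<bar> \<le> \<bar>h\<bar>" "exp h = (\<Sum>m<3. h ^ m / fact m) + exp t / fact 3 * h ^ 3"
    using Maclaurin_exp_le[of h 3] by blast
  have e: "exp h - 1 = h + (1 / 2 + exp t * h / 6) * h\<^sup>2"
    using t(2) by (simp add: eval_nat_numeral lessThan_Suc algebra_simps fact_numeral)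
  have "exp t \<le> exp 1" using t(1) assms by simp
  then have "exp t \<le> 272 / 100" using e_less_272 by linarith
  then have "exp t * h \<le> 272 / 100 * 1"
  proof (cases "h \<ge> 0")
    case False
    then have "exp t * h \<le> 0" by (simp add: mult_nonneg_nonpos)
    then show ?thesis by simp
  qed (use assms in \<open>intro mult_mono, auto\<close>)
  then have "(1 / 2 + exp t * h / 6) * h\<^sup>2 \<le> 24 / 25 * h\<^sup>2"
    by (intro mult_right_mono) auto
  then show ?thesis using e by simp
qed

text \<open>Collects what both losses share. \<open>exp_le_ell\<close> makes the loss comparable to
  the exponential on sublevel sets. \<open>ell_step\<close> is a multiplicative smoothness bound: an
  equality for \<open>ell_exp\<close>, and a consequence of \<open>ln s \<le> s - 1\<close> for
  \<open>ell_log\<close>.\<close>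

locale convex_loss =
  fixes ell ell' ell'' :: "real \<Rightarrow> real"
  assumes ell_deriv: "(ell has_real_derivative ell' z) (at z)"
    and ell'_deriv: "(ell' has_real_derivative ell'' z) (at z)"
    and ell''_cont: "continuous_on UNIV ell''"
    and ell''_pos: "0 < ell'' z"
    and ell'_pos: "0 < ell' z"
    and ell'_le: "ell' z \<le> ell z"
    and ell_le_exp: "ell z \<le> exp z"
    and ell_ge_self: "z \<le> ell z"
    and exp_le_ell: "\<lbrakk>0 \<le> M; ell z \<le> M\<rbrakk> \<Longrightarrow> exp z \<le> exp M * ell z"
    and ell_0: "ell 0 \<le> 1"
    and ell_step: "ell (z + h) \<le> ell z + ell' z * (exp h - 1)"
begin

lemma ell_pos: "0 < ell z"
  using ell'_pos ell'_le by (rule less_le_trans)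

lemma ell_tangent: "ell' a * (b - a) \<le> ell b - ell a"
  by (rule f''_imp_f'[where C = UNIV and f'' = ell''])
     (auto intro: ell_deriv ell'_deriv less_imp_le[OF ell''_pos])

lemma ell_continuous: "continuous_on A ell"
  by (meson DERIV_isCont continuous_at_imp_continuous_on ell_deriv)

text \<open>Strong convexity on a bounded interval: \<open>ell''\<close> has a positive minimum
  \<mu> there, so \<open>ell z - \<mu> / 2 * z\<^sup>2\<close> is convex, and its midpoint
  inequality yields the constant \<open>\<mu> / 8\<close>.\<close>

lemma ell_midpoint:
  obtains m where "m > 0"
    "\<And>a b. \<lbrakk>\<bar>a\<bar> \<le> B; \<bar>b\<bar> \<le> B\<rbrakk> \<Longrightarrow> ell ((a + b) / 2) \<le> (ell a + ell b) / 2 - m * (a - b)\<^sup>2"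
proof (cases "B \<ge> 0")
  case True
  have "compact {-B..B}" "{-B..B} \<noteq> {}" "continuous_on {-B..B} ell''"
    using True ell''_cont continuous_on_subset by auto
  then obtain z0 where z0: "\<And>z. z \<in> {-B..B} \<Longrightarrow> ell'' z0 \<le> ell'' z"
    using continuous_attains_inf[of "{-B..B}" ell''] by blast
  define \<mu> where "\<mu> = ell'' z0"
  have "convex_on {-B..B} (\<lambda>z. ell z - \<mu> / 2 * z\<^sup>2)"
  proof (rule f''_ge0_imp_convex)
    show "((\<lambda>z. ell z - \<mu> / 2 * z\<^sup>2) has_real_derivative ell' z - \<mu> * z) (at z)" for z
      by (auto intro!: derivative_eq_intros ell_deriv)
    show "((\<lambda>z. ell' z - \<mu> * z) has_real_derivative ell'' z - \<mu>) (at z)" for z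
      by (auto intro!: derivative_eq_intros ell'_deriv)
  qed (use z0 in \<open>auto simp: \<mu>_def\<close>)
  then have conv: "ell ((1/2) *\<^sub>R a + (1/2) *\<^sub>R b) - \<mu> / 2 * ((1/2) *\<^sub>R a + (1/2) *\<^sub>R b)\<^sup>2
      \<le> (1/2) * (ell a - \<mu> / 2 * a\<^sup>2) + (1/2) * (ell b - \<mu> / 2 * b\<^sup>2)"
    if "\<bar>a\<bar> \<le> B" "\<bar>b\<bar> \<le> B" for a b
    using convex_onD[of "{-B..B}" _ "1/2" a b] that by (auto simp: abs_le_iff)
  show ?thesis
  proof (rule that)
    show "\<mu> / 8 > 0" by (simp add: \<mu>_def ell''_pos)
    fix a b assume "\<bar>a\<bar> \<le> B" "\<bar>b\<bar> \<le> B"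
    from conv[OF this] show "ell ((a + b) / 2) \<le> (ell a + ell b) / 2 - \<mu> / 8 * (a - b)\<^sup>2"
      by (simp add: power2_eq_square field_simps)
  qed
qed (auto intro: that[of 1])

text \<open>Smoothness with a curvature proportional to the loss value. It replaces a global
  Lipschitz bound on the derivative, which the exponential loss does not have.\<close>

lemma ell_quadratic_step:
  assumes "\<bar>h\<bar> \<le> 1"
  shows "ell (z + h) \<le> ell z + ell' z * h + 24 / 25 * ell z * h\<^sup>2"
proof -
  have "ell' z * (exp h - 1) \<le> ell' z * (h + 24 / 25 * h\<^sup>2)"
    using exp_quadratic_bound[OF assms] less_imp_le[OF ell'_pos] by (rule mult_left_mono)
  also have "\<dots> \<le> ell' z * h + 24 / 25 * ell z * h\<^sup>2"
    using mult_right_mono[OF ell'_le, of "24 / 25 * h\<^sup>2" z] by (simp add: algebra_simps)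
  finally show ?thesis using ell_step[of z h] by simp
qed

end

lemma convex_loss_exp: "convex_loss ell_exp exp exp"
proof unfold_locales
  show "exp z \<le> exp M * ell_exp z" if "0 \<le> M" for M z
    using that by (simp add: ell_exp_def)
  show "z \<le> ell_exp z" for z
    unfolding ell_exp_def using exp_ge_add_one_self[of z] by linarith
qed (auto simp: ell_exp_def[abs_def] exp_add algebra_simps intro!: derivative_eq_intros continuous_intros)

lemma convex_loss_log:
  "convex_loss ell_log (\<lambda>z. exp z / (1 + exp z)) (\<lambda>z. exp z / (1 + exp z)\<^sup>2)"
proof unfold_locales
  fix z h M :: real
  have p: "0 < 1 + exp z" by (simp add: add_pos_pos)
  then have nz: "1 + exp z \<noteq> 0" by simp
  show "(ell_log has_real_derivative exp z / (1 + exp z)) (at z)"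
    unfolding ell_log_def[abs_def] using p by (auto intro!: derivative_eq_intros simp: field_simps)
  show "((\<lambda>z. exp z / (1 + exp z)) has_real_derivative exp z / (1 + exp z)\<^sup>2) (at z)"
    using nz by (auto intro!: derivative_eq_intros simp: power2_eq_square field_simps)
  show "0 < exp z / (1 + exp z)\<^sup>2" "0 < exp z / (1 + exp z)" using p by auto
  \<comment> \<open>\<open>ln s \<le> s - 1\<close> at \<open>s = 1 / (1 + exp z)\<close>, with the
    signs reversed afterwards.\<close>
  have "ln (inverse (1 + exp z)) \<le> inverse (1 + exp z) - 1"
    by (rule ln_le_minus_one) (use p in simp)
  moreover have "1 - inverse (1 + exp z) = exp z / (1 + exp z)" using nz by (simp add: field_simps)
  ultimately show "exp z / (1 + exp z) \<le> ell_log z"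
    using p by (simp add: ell_log_def ln_inverse)
  show "ell_log z \<le> exp z" unfolding ell_log_def by (rule ln_add_one_self_le_self) simp
  have "ln (exp z) \<le> ln (1 + exp z)" by (subst ln_le_cancel_iff) (use p in auto)
  then show "z \<le> ell_log z" by (simp add: ell_log_def)
  have "ell_log 0 = ln 2" by (simp add: ell_log_def)
  then show "ell_log 0 \<le> 1" using ln_2_less_1 by linarith
  show "exp z \<le> exp M * ell_log z" if "0 \<le> M" "ell_log z \<le> M"
  proof -
    have l: "0 \<le> ell_log z" by (simp add: ell_log_def)
    \<comment> \<open>With \<open>l = ell_log z\<close> one has \<open>exp z = exp l - 1\<close>;
      factoring out \<open>exp l\<close> leaves \<open>1 - exp (- l)\<close>, which is at most
      \<open>l\<close>.\<close>
    have "exp z = exp (ell_log z) * (1 - exp (- ell_log z))"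
      using p nz by (simp add: ell_log_def exp_minus field_simps)
    also have "\<dots> \<le> exp (ell_log z) * ell_log z"
      using exp_ge_add_one_self[of "- ell_log z"] by (intro mult_left_mono) auto
    also have "\<dots> \<le> exp M * ell_log z" using that l by (intro mult_right_mono) auto
    finally show ?thesis .
  qed
  have q: "0 < 1 + exp (z + h)" by (simp add: add_pos_pos)
  have "ell_log (z + h) - ell_log z = ln ((1 + exp (z + h)) / (1 + exp z))"
    unfolding ell_log_def using p q by (simp add: ln_div)
  also have "\<dots> \<le> (1 + exp (z + h)) / (1 + exp z) - 1"
    by (rule ln_le_minus_one) (use p q in simp)
  also have "\<dots> = exp z / (1 + exp z) * (exp h - 1)"
    using nz by (simp add: field_simps exp_add)
  finally show "ell_log (z + h) \<le> ell_log z + exp z / (1 + exp z) * (exp h - 1)" by simp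
next
  have "1 + exp z \<noteq> 0" for z :: real using exp_gt_zero[of z] by linarith
  then show "continuous_on UNIV (\<lambda>z :: real. exp z / (1 + exp z)\<^sup>2)"
    by (auto intro!: continuous_intros)
qed

section \<open>Orthogonal projections\<close>

lemma inner_orthogonal_comp: "u \<in> S \<Longrightarrow> v \<in> S\<^sup>\<bottom> \<Longrightarrow> u \<bullet> v = 0"
  by (simp add: orthogonal_comp_def orthogonal_def)

text \<open>Two candidates differ by a vector of \<open>S\<close> that, as a difference of
  residuals, is orthogonal to itself. This resolves the \<open>THE\<close> in the
  definition.\<close>

lemma orth_proj_eqI:
  assumes "subspace S" "p \<in> S" "w - p \<in> S\<^sup>\<bottom>"
  shows "orth_proj S w = p"
  unfolding orth_proj_def
proof (rule the_equality)
  fix q assume q: "q \<in> S \<and> w - q \<in> S\<^sup>\<bottom>"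
  then have "q - p \<in> S" using assms by (simp add: subspace_diff)
  then have "(q - p) \<bullet> ((w - p) - (w - q)) = 0"
    unfolding inner_diff_right[of _ "w - p"] using q assms by (simp add: inner_orthogonal_comp)
  then show "q = p" by simp
qed (use assms in simp)

lemma orth_proj:
  fixes S :: "'a::euclidean_space set"
  assumes "subspace S"
  shows orth_proj_in: "orth_proj S w \<in> S"
    and diff_orth_proj_in: "w - orth_proj S w \<in> S\<^sup>\<bottom>"
proof -
  obtain p q where "p \<in> span S" "\<And>u. u \<in> span S \<Longrightarrow> orthogonal q u" "w = p + q"
    using orthogonal_subspace_decomp_exists[of S w] by blast
  then have "p \<in> S" "w - p \<in> S\<^sup>\<bottom>"
    using assms by (auto simp: orthogonal_comp_def span_eq_iff[THEN iffD2] orthogonal_commute)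
  moreover from this have "orth_proj S w = p" using assms by (simp add: orth_proj_eqI)
  ultimately show "orth_proj S w \<in> S" "w - orth_proj S w \<in> S\<^sup>\<bottom>" by simp_all
qed

lemma orth_proj_orthogonal_comp:
  fixes S :: "'a::euclidean_space set"
  assumes "subspace S"
  shows "orth_proj (S\<^sup>\<bottom>) w = w - orth_proj S w"
proof (rule orth_proj_eqI)
  show "w - (w - orth_proj S w) \<in> S\<^sup>\<bottom>\<^sup>\<bottom>"
    using orth_proj_in[OF assms, of w] by (auto simp: orthogonal_comp_def orthogonal_commute)
qed (use assms in \<open>auto simp: subspace_orthogonal_comp diff_orth_proj_in\<close>)

section \<open>The structure of the empirical risk\<close>

text \<open>The vector \<open>a i\<close> stands for the row - y_i x_i; the argument is carried out
  for these rows alone, and \<open>matrix_erm\<close> translates back to the data.\<close>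

locale linear_erm = convex_loss ell ell' ell'' for ell ell' ell'' +
  fixes a :: "'n::finite \<Rightarrow> 'a::euclidean_space"
  assumes norm_a: "norm (a i) \<le> 1"
begin

definition C :: "'n set" where
  "C = {i. \<exists>u. (\<forall>k. a k \<bullet> u \<le> 0) \<and> a i \<bullet> u < 0}"

definition S :: "'a set" where
  "S = span (a ` (- C))"

definition R :: "'a \<Rightarrow> real" where
  "R w = (1 / real CARD('n)) * (\<Sum>i\<in>UNIV. ell (a i \<bullet> w))"

definition LS :: "'a \<Rightarrow> real" where
  "LS v = (\<Sum>i\<in>-C. ell (a i \<bullet> v))"

definition LC :: "'a \<Rightarrow> real" where
  "LC v = (\<Sum>i\<in>C. ell (a i \<bullet> v))"

section \<open>Separation of the rows in \<open>C\<close> and coercivity on \<open>S\<close>\<close>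

lemma abs_inner_a: "\<bar>a i \<bullet> w\<bar> \<le> norm w"
  by (rule order_trans[OF Cauchy_Schwarz_ineq2]) (simp add: norm_a mult_left_le_one_le)

lemma subspace_S: "subspace S" unfolding S_def by (rule subspace_span)

lemma a_in_S: "i \<notin> C \<Longrightarrow> a i \<in> S" unfolding S_def by (rule span_base) simp

lemma inner_a_orth_proj: "i \<notin> C \<Longrightarrow> a i \<bullet> orth_proj S w = a i \<bullet> w"
  using inner_orthogonal_comp[OF a_in_S diff_orth_proj_in[OF subspace_S, of w], of i]
  by (simp add: inner_diff_right)

text \<open>Each row of \<open>C\<close> has a witness. Scaled so that its own row takes the value
  -1, it can only lower every other row, so the sum of the witnesses serves all of \<open>C\<close>.
  A row outside \<open>C\<close> cannot be negative on this sum, since that would put it into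
  \<open>C\<close>.\<close>

lemma separator:
  obtains u where "\<And>i. i \<in> C \<Longrightarrow> a i \<bullet> u \<le> -1" "\<And>i. i \<notin> C \<Longrightarrow> a i \<bullet> u = 0"
proof -
  have "\<forall>i\<in>C. \<exists>u. (\<forall>k. a k \<bullet> u \<le> 0) \<and> a i \<bullet> u < 0" by (auto simp: C_def)
  then obtain f where f: "\<And>i k. i \<in> C \<Longrightarrow> a k \<bullet> f i \<le> 0" "\<And>i. i \<in> C \<Longrightarrow> a i \<bullet> f i < 0"
    by metis
  define u where "u = (\<Sum>i\<in>C. f i /\<^sub>R (- (a i \<bullet> f i)))"
  have term_le: "a k \<bullet> (f i /\<^sub>R (- (a i \<bullet> f i))) \<le> 0" if "i \<in> C" for i k
    using f[OF that] by (auto simp: mult_nonneg_nonpos divide_nonpos_neg mult_nonpos_nonpos)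
  have le0: "a k \<bullet> u \<le> 0" for k
    unfolding u_def inner_sum_right by (intro sum_nonpos term_le)
  have "a i \<bullet> u \<le> -1" if "i \<in> C" for i
  proof -
    have "(\<Sum>j\<in>C - {i}. a i \<bullet> (f j /\<^sub>R (- (a j \<bullet> f j)))) \<le> 0"
      by (intro sum_nonpos term_le) auto
    then have "a i \<bullet> u \<le> a i \<bullet> (f i /\<^sub>R (- (a i \<bullet> f i)))"
      unfolding u_def sum.remove[OF finite that] inner_add_right inner_sum_right by linarith
    also have "\<dots> = -1" using f(2)[OF that] by simp
    finally show ?thesis .
  qed
  moreover have "a i \<bullet> u = 0" if "i \<notin> C" for i
    using that le0 by (auto simp: C_def not_less intro: antisym)
  ultimately show ?thesis using that by blast
qed

text \<open>Were no row of \<open>S\<close> positive on \<open>v\<close>, adding a large multiple of a separator of \<open>C\<close> to \<open>v\<close>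
  would put one of these rows into \<open>C\<close>.\<close>

lemma exists_pos_row:
  assumes v: "v \<in> S" "v \<noteq> 0"
  shows "\<exists>i\<in>-C. 0 < a i \<bullet> v"
proof (rule ccontr)
  assume "\<not> ?thesis"
  then have nonpos: "a i \<bullet> v \<le> 0" if "i \<notin> C" for i using that by force
  \<comment> \<open>Otherwise \<open>v\<close>, lying in the span of these rows, would be orthogonal
    to itself.\<close>
  have "\<exists>i\<in>-C. a i \<bullet> v \<noteq> 0"
  proof (rule ccontr)
    assume "\<not> ?thesis"
    then have "orthogonal v x" if "x \<in> a ` (- C)" for x
      using that by (auto simp: orthogonal_def inner_commute)
    then have "orthogonal v v"
      using v(1) unfolding S_def by (rule orthogonal_to_span[rotated])
    then show False using v(2) by (simp add: orthogonal_def)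
  qed
  then obtain i where i: "i \<notin> C" "a i \<bullet> v < 0" using nonpos by force
  obtain u where u: "\<And>i. i \<in> C \<Longrightarrow> a i \<bullet> u \<le> -1" "\<And>i. i \<notin> C \<Longrightarrow> a i \<bullet> u = 0"
    by (rule separator) blast
  \<comment> \<open>The factor \<open>norm v\<close> is large enough: on \<open>C\<close> the
    separator is at most -1, while \<open>\<bar>a k \<bullet> v\<bar> \<le> norm v\<close>.\<close>
  define w where "w = v + norm v *\<^sub>R u"
  have "a k \<bullet> w \<le> 0" for k
  proof (cases "k \<in> C")
    case True
    have "a k \<bullet> w \<le> norm v + norm v * (-1)"
      unfolding w_def inner_add_right inner_scaleR_right
      using u(1)[OF True] abs_inner_a[of k v] by (intro add_mono mult_left_mono) auto
    then show ?thesis by simp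
  qed (simp add: w_def inner_add_right u(2) nonpos)
  moreover have "a i \<bullet> w < 0" using i by (simp add: w_def inner_add_right u(2))
  ultimately show False using i(1) by (auto simp: C_def)
qed

text \<open>The sum of positive parts is continuous and positively homogeneous, and by
  \<open>exists_pos_row\<close> it is positive on the compact unit sphere of \<open>S\<close>, so
  its minimum there is a valid constant.\<close>

lemma coercive:
  obtains \<mu> where "\<mu> > 0" "\<And>v. v \<in> S \<Longrightarrow> \<mu> * norm v \<le> (\<Sum>i\<in>-C. max 0 (a i \<bullet> v))"
proof -
  let ?h = "\<lambda>v. \<Sum>i\<in>-C. max 0 (a i \<bullet> v)"
  let ?K = "S \<inter> sphere 0 1"
  have scale: "?h (c *\<^sub>R v) = c * ?h v" if "c \<ge> 0" for c v
    using that by (auto simp: sum_distrib_left max_def mult_le_0_iff zero_le_mult_iff intro!: sum.cong)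
  have pos: "0 < ?h v" if "v \<in> S" "v \<noteq> 0" for v
  proof -
    obtain i where "i \<in> -C" "0 < a i \<bullet> v" using exists_pos_row \<open>v \<in> S\<close> \<open>v \<noteq> 0\<close> by blast
    then show ?thesis by (intro sum_pos2[of _ i]) auto
  qed
  have "\<exists>\<mu>>0. \<forall>v\<in>?K. \<mu> \<le> ?h v"
  \<comment> \<open>If \<open>S\<close> is trivial it has no unit vector, and the constant 1
    serves.\<close>
  proof (cases "?K = {}")
    case False
    have "compact ?K" using closed_subspace[OF subspace_S] by (simp add: closed_Int_compact)
    moreover have "continuous_on ?K ?h" by (intro continuous_intros)
    ultimately obtain v0 where v0: "v0 \<in> ?K" "\<And>v. v \<in> ?K \<Longrightarrow> ?h v0 \<le> ?h v"
      using continuous_attains_inf[of ?K ?h] False by blast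
    have "0 < ?h v0" using v0(1) by (intro pos) auto
    then show ?thesis using v0(2) by blast
  qed (auto intro: exI[of _ 1])
  then obtain \<mu> where \<mu>: "\<mu> > 0" "\<And>v. v \<in> ?K \<Longrightarrow> \<mu> \<le> ?h v" by blast
  have "\<mu> * norm v \<le> ?h v" if v: "v \<in> S" for v
  proof (cases "v = 0")
    case False
    have "v /\<^sub>R norm v \<in> ?K" using v False subspace_S by (simp add: subspace_scale)
    then have "\<mu> \<le> ?h (v /\<^sub>R norm v)" by (rule \<mu>(2))
    also have "\<dots> = ?h v / norm v" by (subst scale) (simp_all add: divide_inverse_commute)
    finally have "\<mu> \<le> ?h v / norm v" .
    then show ?thesis using False by (simp add: field_simps)
  qed simp
  then show ?thesis using that \<mu>(1) by blast
qed

section \<open>The loss on \<open>S\<close>: existence of the minimizer and quadratic growth\<close>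

lemma R_split: "real CARD('n) * R w = LS w + LC w"
  unfolding R_def LS_def LC_def
  using sum.subset_diff[of C UNIV "\<lambda>i. ell (a i \<bullet> w)"] by (simp add: Compl_eq_Diff_UNIV add.commute)

lemma LC_nonneg: "0 \<le> LC w" unfolding LC_def by (simp add: sum_nonneg less_imp_le ell_pos)

lemma LS_nonneg: "0 \<le> LS w" unfolding LS_def by (simp add: sum_nonneg less_imp_le ell_pos)

lemma R_0: "R 0 \<le> 1"
proof -
  have "(\<Sum>i\<in>(UNIV::'n set). ell (a i \<bullet> 0)) \<le> (\<Sum>i\<in>(UNIV::'n set). 1)"
    by (intro sum_mono) (simp add: ell_0)
  then show ?thesis by (simp add: R_def)
qed

lemma LS_0: "LS 0 \<le> real CARD('n)"
  using R_split[of 0] LC_nonneg[of 0] mult_left_mono[OF R_0, of "real CARD('n)"] by simp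

lemma LS_orth_proj: "LS (orth_proj S w) = LS w"
  unfolding LS_def by (intro sum.cong) (auto simp: inner_a_orth_proj)

lemma LS_continuous: "continuous_on A LS"
  unfolding LS_def
  by (intro continuous_intros continuous_on_compose2[OF ell_continuous[of UNIV]]) auto

lemma R_continuous: "continuous_on A R"
  unfolding R_def
  by (intro continuous_intros continuous_on_compose2[OF ell_continuous[of UNIV]]) auto

text \<open>The loss dominates the positive part, so \<open>coercive\<close> bounds the sublevel
  set. The level \<open>CARD('n)\<close> is the one below which \<open>LS w\<close> stays whenever
  \<open>R w \<le> 1\<close>.\<close>

lemma LS_coercive:
  obtains B where "B \<ge> 0" "\<And>v. \<lbrakk>v \<in> S; LS v \<le> real CARD('n)\<rbrakk> \<Longrightarrow> norm v \<le> B"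
proof -
  obtain \<mu> where \<mu>: "\<mu> > 0" "\<And>v. v \<in> S \<Longrightarrow> \<mu> * norm v \<le> (\<Sum>i\<in>-C. max 0 (a i \<bullet> v))"
    by (rule coercive) blast
  have "norm v \<le> real CARD('n) / \<mu>" if "v \<in> S" "LS v \<le> real CARD('n)" for v
  proof -
    have "(\<Sum>i\<in>-C. max 0 (a i \<bullet> v)) \<le> LS v"
      unfolding LS_def by (intro sum_mono) (simp add: ell_ge_self less_imp_le[OF ell_pos])
    then have "\<mu> * norm v \<le> real CARD('n)" using \<mu>(2)[of v] that by linarith
    then show ?thesis using \<mu>(1) by (simp add: field_simps)
  qed
  then show ?thesis using that[of "real CARD('n) / \<mu>"] \<mu>(1) by simp
qed

text \<open>Points of \<open>S\<close> outside the ball from \<open>LS_coercive\<close> do worse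
  than 0, so it is enough to minimize over a compact set.\<close>

lemma minimizer_exists: "\<exists>v\<in>S. \<forall>u\<in>S. LS v \<le> LS u"
proof -
  obtain B where B: "B \<ge> 0" "\<And>v. \<lbrakk>v \<in> S; LS v \<le> real CARD('n)\<rbrakk> \<Longrightarrow> norm v \<le> B"
    by (rule LS_coercive) blast
  have z: "0 \<in> S \<inter> cball 0 B" using B subspace_0[OF subspace_S] by simp
  have "compact (S \<inter> cball 0 B)"
    using closed_subspace[OF subspace_S] by (simp add: closed_Int_compact)
  then obtain v where v: "v \<in> S \<inter> cball 0 B" "\<And>u. u \<in> S \<inter> cball 0 B \<Longrightarrow> LS v \<le> LS u"
    using continuous_attains_inf[of "S \<inter> cball 0 B" LS] z LS_continuous by blast
  have "LS v \<le> LS u" if "u \<in> S" for u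
  proof (cases "LS u \<le> real CARD('n)")
    case True then show ?thesis using v(2) B(2) that by simp
  next
    case False then show ?thesis using v(2)[OF z] LS_0 by linarith
  qed
  then show ?thesis using v(1) by blast
qed

text \<open>Any minimizer is chosen here; its uniqueness comes later, from quadratic growth around
  the chosen one.\<close>

definition vbar :: 'a where
  "vbar = (SOME v. v \<in> S \<and> (\<forall>u\<in>S. LS v \<le> LS u))"

lemma vbar_in: "vbar \<in> S" and vbar_min: "u \<in> S \<Longrightarrow> LS vbar \<le> LS u"
  unfolding vbar_def using someI_ex[of "\<lambda>v. v \<in> S \<and> (\<forall>u\<in>S. LS v \<le> LS u)"] minimizer_exists by blast+

text \<open>The midpoint of \<open>v\<close> and \<open>vbar\<close> lies in \<open>S\<close>, so
  its loss is at least \<open>LS vbar\<close>. Strong midpoint convexity of each summand then bounds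
  the gap below by \<open>2 * m\<close> times the sum of the squares of
  \<open>a i \<bullet> (v - vbar)\<close>.\<close>

lemma quadratic_growth:
  obtains \<kappa> where "\<kappa> > 0" "\<And>v. \<lbrakk>v \<in> S; LS v \<le> real CARD('n)\<rbrakk> \<Longrightarrow> \<kappa> * (norm (v - vbar))\<^sup>2 \<le> LS v - LS vbar"
proof -
  obtain B where B: "B \<ge> 0" "\<And>v. \<lbrakk>v \<in> S; LS v \<le> real CARD('n)\<rbrakk> \<Longrightarrow> norm v \<le> B"
    by (rule LS_coercive) blast
  obtain \<mu> where \<mu>: "\<mu> > 0" "\<And>v. v \<in> S \<Longrightarrow> \<mu> * norm v \<le> (\<Sum>i\<in>-C. max 0 (a i \<bullet> v))"
    by (rule coercive) blast
  obtain m where m: "m > 0"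
    "\<And>s t. \<lbrakk>\<bar>s\<bar> \<le> B; \<bar>t\<bar> \<le> B\<rbrakk> \<Longrightarrow> ell ((s + t) / 2) \<le> (ell s + ell t) / 2 - m * (s - t)\<^sup>2"
    by (rule ell_midpoint) blast
  have nb: "norm vbar \<le> B"
    using B(2)[OF vbar_in] vbar_min[OF subspace_0[OF subspace_S]] LS_0 by linarith
  have "2 * m * \<mu>\<^sup>2 / real CARD('n) * (norm (v - vbar))\<^sup>2 \<le> LS v - LS vbar" if v: "v \<in> S" "LS v \<le> real CARD('n)" for v
  proof -
    have nv: "norm v \<le> B" using B(2) v by blast
    have d: "v - vbar \<in> S" using v vbar_in subspace_S by (simp add: subspace_diff)
    let ?mid = "(1/2) *\<^sub>R (v + vbar)"
    have "?mid \<in> S" using v vbar_in subspace_S by (simp add: subspace_add subspace_scale)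
    then have "LS vbar \<le> LS ?mid" by (rule vbar_min)
    also have "\<dots> \<le> (\<Sum>i\<in>-C. (ell (a i \<bullet> v) + ell (a i \<bullet> vbar)) / 2 - m * (a i \<bullet> v - a i \<bullet> vbar)\<^sup>2)"
      unfolding LS_def
    proof (rule sum_mono)
      fix i
      have "\<bar>a i \<bullet> v\<bar> \<le> B" "\<bar>a i \<bullet> vbar\<bar> \<le> B"
        using abs_inner_a[of i v] abs_inner_a[of i vbar] nv nb by linarith+
      from m(2)[OF this]
      show "ell (a i \<bullet> ?mid) \<le> (ell (a i \<bullet> v) + ell (a i \<bullet> vbar)) / 2 - m * (a i \<bullet> v - a i \<bullet> vbar)\<^sup>2"
        by (simp add: inner_add_right)
    qed
    also have "\<dots> = (LS v + LS vbar) / 2 - m * (\<Sum>i\<in>-C. (a i \<bullet> (v - vbar))\<^sup>2)"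
      unfolding LS_def
      by (simp add: sum_subtractf sum.distrib sum_divide_distrib sum_distrib_left inner_diff_right add_divide_distrib)
    finally have A: "2 * (m * (\<Sum>i\<in>-C. (a i \<bullet> (v - vbar))\<^sup>2)) \<le> LS v - LS vbar" by argo
    \<comment> \<open>Coercivity bounds the norm by a sum of positive parts; Cauchy-Schwarz passes
      to the sum of squares at the cost of a factor \<open>CARD('n)\<close>.\<close>
    have "(\<mu> * norm (v - vbar))\<^sup>2 \<le> (\<Sum>i\<in>-C. max 0 (a i \<bullet> (v - vbar)))\<^sup>2"
      using \<mu>(1) \<mu>(2)[OF d] by (intro power_mono) auto
    also have "\<dots> \<le> (\<Sum>i\<in>-C. (max 0 (a i \<bullet> (v - vbar)))\<^sup>2) * card (-C)"
      by (rule sum_squared_le_sum_of_squares)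
    also have "\<dots> \<le> (\<Sum>i\<in>-C. (a i \<bullet> (v - vbar))\<^sup>2) * real CARD('n)"
      by (intro mult_mono sum_mono) (auto simp: max_def sum_nonneg card_mono)
    finally have "\<mu>\<^sup>2 / real CARD('n) * (norm (v - vbar))\<^sup>2 \<le> (\<Sum>i\<in>-C. (a i \<bullet> (v - vbar))\<^sup>2)"
      by (simp add: field_simps power_mult_distrib)
    then have "2 * m * (\<mu>\<^sup>2 / real CARD('n) * (norm (v - vbar))\<^sup>2) \<le> 2 * m * (\<Sum>i\<in>-C. (a i \<bullet> (v - vbar))\<^sup>2)"
      using m(1) by (intro mult_left_mono) auto
    then show ?thesis using A by (simp add: mult.assoc)
  qed
  moreover have "2 * m * \<mu>\<^sup>2 / real CARD('n) > 0" using m \<mu> by simp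
  ultimately show ?thesis using that by blast
qed

lemma vbar_unique:
  assumes "v \<in> S" "\<And>u. u \<in> S \<Longrightarrow> LS v \<le> LS u"
  shows "v = vbar"
proof -
  obtain \<kappa> where \<kappa>: "\<kappa> > 0" "\<And>v. \<lbrakk>v \<in> S; LS v \<le> real CARD('n)\<rbrakk> \<Longrightarrow> \<kappa> * (norm (v - vbar))\<^sup>2 \<le> LS v - LS vbar"
    by (rule quadratic_growth) blast
  have "LS v \<le> real CARD('n)" using assms(2)[OF subspace_0[OF subspace_S]] LS_0 by linarith
  then have "\<kappa> * (norm (v - vbar))\<^sup>2 \<le> 0" using \<kappa>(2)[OF assms(1)] assms(2)[OF vbar_in] by simp
  then show ?thesis using \<kappa>(1) by (simp add: mult_le_0_iff)
qed

section \<open>Excess risk over the infimum\<close>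

definition excess :: "'a \<Rightarrow> real" where
  "excess w = R w - LS vbar / real CARD('n)"

lemma excess_ge: "(LS w - LS vbar) / real CARD('n) + LC w / real CARD('n) \<le> excess w"
  using R_split[of w] by (simp add: excess_def field_simps)

lemma LS_ge: "LS vbar \<le> LS w"
  using vbar_min[OF orth_proj_in[OF subspace_S]] by (simp add: LS_orth_proj)

lemma excess_nonneg: "0 \<le> excess w"
proof -
  have "0 \<le> (LS w - LS vbar) / real CARD('n) + LC w / real CARD('n)"
    by (intro add_nonneg_nonneg divide_nonneg_nonneg) (simp_all add: LS_ge LC_nonneg)
  then show ?thesis using excess_ge[of w] by linarith
qed

lemma excess_0: "excess 0 \<le> 1"
  using R_0 divide_nonneg_nonneg[OF LS_nonneg[of vbar] of_nat_0_le_iff[of "CARD('n)"]]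
  unfolding excess_def by linarith

lemma LS_le_N: "R w \<le> 1 \<Longrightarrow> LS w \<le> real CARD('n)"
  using R_split[of w] LC_nonneg[of w] mult_left_mono[of "R w" 1 "real CARD('n)"] by simp

lemma proj_growth:
  obtains \<kappa> where "\<kappa> > 0" "\<And>w. R w \<le> 1 \<Longrightarrow> \<kappa> * (norm (orth_proj S w - vbar))\<^sup>2 \<le> excess w"
proof -
  obtain \<kappa> where \<kappa>: "\<kappa> > 0" "\<And>v. \<lbrakk>v \<in> S; LS v \<le> real CARD('n)\<rbrakk> \<Longrightarrow> \<kappa> * (norm (v - vbar))\<^sup>2 \<le> LS v - LS vbar"
    by (rule quadratic_growth) blast
  have "\<kappa> / real CARD('n) * (norm (orth_proj S w - vbar))\<^sup>2 \<le> excess w" if "R w \<le> 1" for w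
  proof -
    have "\<kappa> * (norm (orth_proj S w - vbar))\<^sup>2 / real CARD('n) \<le> (LS w - LS vbar) / real CARD('n)"
      using \<kappa>(2)[OF orth_proj_in[OF subspace_S], of w] LS_le_N[OF that]
      by (intro divide_right_mono) (auto simp: LS_orth_proj)
    then show ?thesis using excess_ge[of w] LC_nonneg[of w]
      by (smt (verit) divide_nonneg_nonneg of_nat_0_le_iff times_divide_eq_left)
  qed
  then show ?thesis using that[of "\<kappa> / real CARD('n)"] \<kappa>(1) by simp
qed

text \<open>Because \<open>LS w\<close> is at least \<open>LS vbar\<close>, the loss of a single row
  of \<open>C\<close> is paid for by the excess. The bound \<open>R w \<le> 1\<close> keeps this
  loss below \<open>CARD('n)\<close>, where it controls the exponential.\<close>

lemma exp_row_le_excess: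
  assumes "i \<in> C" "R w \<le> 1"
  shows "exp (a i \<bullet> w) \<le> real CARD('n) * exp (real CARD('n)) * excess w"
proof -
  have "ell (a i \<bullet> w) \<le> LC w"
    unfolding LC_def using assms(1) by (intro member_le_sum) (auto simp: less_imp_le[OF ell_pos])
  also have "\<dots> \<le> real CARD('n) * excess w"
    using R_split[of w] LS_ge[of w] by (simp add: excess_def field_simps)
  finally have 1: "ell (a i \<bullet> w) \<le> real CARD('n) * excess w" .
  have "ell (a i \<bullet> w) \<le> real CARD('n)"
    using \<open>ell (a i \<bullet> w) \<le> LC w\<close> R_split[of w] LS_nonneg[of w] mult_left_mono[OF assms(2), of "real CARD('n)"] by simp
  then have "exp (a i \<bullet> w) \<le> exp (real CARD('n)) * ell (a i \<bullet> w)" by (intro exp_le_ell) auto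
  also have "\<dots> \<le> exp (real CARD('n)) * (real CARD('n) * excess w)" using 1 by simp
  finally show ?thesis by (simp add: mult_ac)
qed

text \<open>Moving along \<open>u\<close> leaves the rows outside \<open>C\<close> unchanged, so the
  excess consists of the losses on \<open>C\<close> alone, and each of these decays like
  \<open>exp (- g * s)\<close>.\<close>

lemma excess_along_separator:
  assumes u: "\<And>i. i \<in> C \<Longrightarrow> a i \<bullet> u \<le> -g" "\<And>i. i \<notin> C \<Longrightarrow> a i \<bullet> u = 0" and s: "s \<ge> 0"
  shows "excess (vbar + s *\<^sub>R u) \<le> exp (norm vbar) * exp (- g * s)"
proof -
  have "LS (vbar + s *\<^sub>R u) = LS vbar"
    unfolding LS_def by (intro sum.cong) (auto simp: inner_add_right u(2))
  then have "real CARD('n) * excess (vbar + s *\<^sub>R u) = LC (vbar + s *\<^sub>R u)"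
    using R_split[of "vbar + s *\<^sub>R u"] by (simp add: excess_def field_simps)
  also have "\<dots> \<le> (\<Sum>i\<in>C. exp (norm vbar + - g * s))"
    unfolding LC_def
  proof (rule sum_mono)
    fix i assume "i \<in> C"
    then have "s * (a i \<bullet> u) \<le> s * (- g)" using u(1) s by (intro mult_left_mono) auto
    then have "a i \<bullet> (vbar + s *\<^sub>R u) \<le> norm vbar + - g * s"
      using abs_inner_a[of i vbar] by (simp add: inner_add_right mult.commute)
    then show "ell (a i \<bullet> (vbar + s *\<^sub>R u)) \<le> exp (norm vbar + - g * s)"
      using ell_le_exp order_trans exp_le_cancel_iff by blast
  qed
  also have "\<dots> \<le> real CARD('n) * exp (norm vbar + - g * s)"
    by (simp add: card_mono)
  finally show ?thesis by (simp add: exp_add[symmetric])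
qed

text \<open>Identifies the constant subtracted in \<open>excess\<close>. The infimum is approached
  along \<open>vbar + k *\<^sub>R u\<close> for a separator \<open>u\<close>; it need not be
  attained.\<close>

lemma Inf_R: "(INF w. R w) = LS vbar / real CARD('n)"
proof (rule antisym)
  have bdd: "bdd_below (range R)"
    using excess_nonneg by (intro bdd_belowI2[of _ "LS vbar / real CARD('n)"]) (simp add: excess_def)
  show "LS vbar / real CARD('n) \<le> (INF w. R w)"
    using excess_nonneg by (intro cINF_greatest) (simp_all add: excess_def)
  obtain u where u: "\<And>i. i \<in> C \<Longrightarrow> a i \<bullet> u \<le> -1" "\<And>i. i \<notin> C \<Longrightarrow> a i \<bullet> u = 0"
    by (rule separator) blast
  have gap: "(INF w. R w) - LS vbar / real CARD('n) \<le> exp (norm vbar) * exp (- 1 * real k)" for k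
  proof -
    have "(INF w. R w) \<le> R (vbar + real k *\<^sub>R u)" using bdd by (rule cINF_lower) simp
    then show ?thesis using excess_along_separator[OF u, of "real k"] by (simp add: excess_def)
  qed
  have "(\<lambda>k. exp (norm vbar) * exp (- 1 * real k)) \<longlonglongrightarrow> 0"
    by (rule tendsto_mult_right_zero) real_asymp
  then have "(INF w. R w) - LS vbar / real CARD('n) \<le> 0"
    by (rule LIMSEQ_le_const) (use gap in blast)
  then show "(INF w. R w) \<le> LS vbar / real CARD('n)" by simp
qed

end

section \<open>Gradient descent\<close>

lemma gradient_eqI:
  assumes "GDERIV f w :> D"
  shows "gradient f w = D"
  unfolding gradient_def
proof (rule the_equality)
  fix E assume "GDERIV f w :> E"
  then have "(\<lambda>h. h \<bullet> E) = (\<lambda>h. h \<bullet> D)"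
    using assms unfolding gderiv_def by (rule has_derivative_unique)
  then have "(E - D) \<bullet> (E - D) = 0" by (metis inner_diff_right right_minus_eq)
  then show "E = D" by simp
qed (fact assms)

context linear_erm
begin

definition grad :: "'a \<Rightarrow> 'a" where
  "grad w = (1 / real CARD('n)) *\<^sub>R (\<Sum>i\<in>UNIV. ell' (a i \<bullet> w) *\<^sub>R a i)"

lemma GDERIV_R: "GDERIV R w :> grad w"
  unfolding gderiv_def R_def[abs_def] grad_def
  by (auto intro!: derivative_eq_intros DERIV_compose_FDERIV[OF ell_deriv] sum.cong
      simp: inner_sum_right inner_commute mult_ac)

lemma R_tangent: "grad w \<bullet> (z - w) \<le> R z - R w"
proof -
  have "grad w \<bullet> (z - w) = (1 / real CARD('n)) * (\<Sum>i\<in>UNIV. ell' (a i \<bullet> w) * (a i \<bullet> z - a i \<bullet> w))"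
    by (simp add: grad_def inner_sum_left inner_diff_right[of "a _"])
  also have "\<dots> \<le> (1 / real CARD('n)) * (\<Sum>i\<in>UNIV. ell (a i \<bullet> z) - ell (a i \<bullet> w))"
    by (intro mult_left_mono sum_mono ell_tangent) auto
  also have "\<dots> = R z - R w" by (simp add: R_def sum_subtractf diff_divide_distrib)
  finally show ?thesis .
qed

text \<open>From \<open>ell' \<le> ell\<close> and rows of norm at most 1. On the set
  \<open>R w \<le> 1\<close>, a step of size at most 1 therefore changes every
  \<open>a i \<bullet> w\<close> by at most 1, as \<open>ell_quadratic_step\<close>
  requires.\<close>

lemma norm_grad_le: "norm (grad w) \<le> R w"
proof -
  have "norm (\<Sum>i\<in>UNIV. ell' (a i \<bullet> w) *\<^sub>R a i) \<le> (\<Sum>i\<in>UNIV. ell (a i \<bullet> w))"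
  proof (rule sum_norm_le)
    fix i
    show "norm (ell' (a i \<bullet> w) *\<^sub>R a i) \<le> ell (a i \<bullet> w)"
      using mult_mono[OF ell'_le norm_a[of i], of "a i \<bullet> w"] less_imp_le[OF ell_pos] less_imp_le[OF ell'_pos]
      by simp
  qed
  then show ?thesis by (simp add: grad_def R_def divide_right_mono)
qed

lemma R_nonneg: "0 \<le> R w"
  using norm_ge_zero norm_grad_le by (rule order_trans)

text \<open>Let \<open>b i\<close> be the change of \<open>a i \<bullet> w\<close> in the step.
  Averaged over the rows, the linear terms give \<open>- \<eta>\<close> times the squared gradient
  norm, and the quadratic ones give back at most 24/25 of it, because \<open>R w \<le> 1\<close> and
  \<open>\<eta>\<^sup>2 \<le> \<eta>\<close>.\<close>

lemma descent:
  assumes "R w \<le> 1" "0 \<le> \<eta>" "\<eta> \<le> 1"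
  shows "R (w - \<eta> *\<^sub>R grad w) \<le> R w - \<eta> / 25 * (norm (grad w))\<^sup>2"
proof -
  define b where "b i = - \<eta> * (a i \<bullet> grad w)" for i
  have b: "\<bar>b i\<bar> \<le> \<eta> * norm (grad w)" for i
    using abs_inner_a[of i "grad w"] assms(2) by (simp add: b_def abs_mult mult_left_mono)
  have "norm (grad w) \<le> 1" using norm_grad_le[of w] assms(1) by linarith
  then have b1: "\<bar>b i\<bar> \<le> 1" for i
    using b[of i] mult_mono[OF assms(3), of "norm (grad w)" 1] by simp
  have b2: "(b i)\<^sup>2 \<le> \<eta>\<^sup>2 * (norm (grad w))\<^sup>2" for i
    using power_mono[OF b, of i 2] by (simp add: power_mult_distrib)
  have lin: "(\<Sum>i\<in>UNIV. ell' (a i \<bullet> w) * b i) = - \<eta> * (real CARD('n) * (norm (grad w))\<^sup>2)"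
  proof -
    have "real CARD('n) * (grad w \<bullet> grad w) = (\<Sum>i\<in>UNIV. ell' (a i \<bullet> w) *\<^sub>R a i) \<bullet> grad w"
      by (subst (1) grad_def) simp
    then show ?thesis
      by (simp add: b_def inner_sum_left power2_norm_eq_inner sum_distrib_left sum_negf mult_ac)
  qed
  have "real CARD('n) * R (w - \<eta> *\<^sub>R grad w) = (\<Sum>i\<in>UNIV. ell (a i \<bullet> w + b i))"
    by (simp add: R_def b_def inner_diff_right)
  also have "\<dots> \<le> (\<Sum>i\<in>UNIV. ell (a i \<bullet> w) + ell' (a i \<bullet> w) * b i
      + 24 / 25 * ell (a i \<bullet> w) * (\<eta>\<^sup>2 * (norm (grad w))\<^sup>2))"
  proof (rule sum_mono)
    fix i
    have "24 / 25 * ell (a i \<bullet> w) * (b i)\<^sup>2 \<le> 24 / 25 * ell (a i \<bullet> w) * (\<eta>\<^sup>2 * (norm (grad w))\<^sup>2)"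
      using b2 less_imp_le[OF ell_pos] by (intro mult_left_mono) auto
    then show "ell (a i \<bullet> w + b i) \<le> ell (a i \<bullet> w) + ell' (a i \<bullet> w) * b i
        + 24 / 25 * ell (a i \<bullet> w) * (\<eta>\<^sup>2 * (norm (grad w))\<^sup>2)"
      using ell_quadratic_step[OF b1[of i], of "a i \<bullet> w"] by linarith
  qed
  also have "\<dots> = real CARD('n) * (R w - \<eta> * (norm (grad w))\<^sup>2
      + 24 / 25 * R w * (\<eta>\<^sup>2 * (norm (grad w))\<^sup>2))"
    unfolding sum.distrib lin sum_distrib_left[symmetric] sum_distrib_right[symmetric]
    by (simp add: R_def field_simps)
  finally have "R (w - \<eta> *\<^sub>R grad w) \<le> R w - \<eta> * (norm (grad w))\<^sup>2
      + 24 / 25 * R w * (\<eta>\<^sup>2 * (norm (grad w))\<^sup>2)" by simp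
  moreover have "24 / 25 * R w * (\<eta>\<^sup>2 * (norm (grad w))\<^sup>2) \<le> 24 / 25 * 1 * (\<eta> * (norm (grad w))\<^sup>2)"
  proof (intro mult_mono)
    show "\<eta>\<^sup>2 \<le> \<eta>" using assms(2,3) by (simp add: power2_eq_square mult_left_le)
  qed (use assms R_nonneg in auto)
  ultimately show ?thesis by simp
qed

section \<open>Monotone descent and the risk bound\<close>

primrec iter :: "(nat \<Rightarrow> real) \<Rightarrow> nat \<Rightarrow> 'a" where
  "iter \<eta> 0 = 0"
| "iter \<eta> (Suc j) = iter \<eta> j - \<eta> j *\<^sub>R grad (iter \<eta> j)"

text \<open>\<open>descent\<close> needs risk at most 1 and itself preserves this, starting from
  \<open>R 0 \<le> 1\<close>.\<close>

lemma R_iter: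
  assumes "\<And>j. 0 \<le> \<eta> j" "\<And>j. \<eta> j \<le> 1"
  shows R_iter_le_1: "R (iter \<eta> t) \<le> 1"
    and R_iter_Suc: "R (iter \<eta> (Suc t)) \<le> R (iter \<eta> t) - \<eta> t / 25 * (norm (grad (iter \<eta> t)))\<^sup>2"
proof -
  show le1: "R (iter \<eta> t) \<le> 1" for t
  proof (induction t)
    case (Suc t)
    have "0 \<le> \<eta> t / 25 * (norm (grad (iter \<eta> t)))\<^sup>2" using assms by simp
    then show ?case using descent[OF Suc assms, of t] Suc by simp
  qed (simp add: R_0)
  show "R (iter \<eta> (Suc t)) \<le> R (iter \<eta> t) - \<eta> t / 25 * (norm (grad (iter \<eta> t)))\<^sup>2"
    using descent[OF le1 assms] by simp
qed

lemma R_iter_antimono: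
  assumes "\<And>j. 0 \<le> \<eta> j" "\<And>j. \<eta> j \<le> 1" "i \<le> j"
  shows "R (iter \<eta> j) \<le> R (iter \<eta> i)"
  using assms(3)
proof (induction rule: dec_induct)
  case (step m)
  have "0 \<le> \<eta> m / 25 * (norm (grad (iter \<eta> m)))\<^sup>2" using assms by simp
  then show ?case using R_iter_Suc[of \<eta> m, OF assms(1,2)] step by linarith
qed simp

text \<open>Expanding the square, convexity bounds the cross term, and \<open>R_iter_Suc\<close>
  bounds the squared gradient by 25 times the risk decrease, which telescopes.\<close>

lemma distance_step:
  assumes "\<And>j. 0 \<le> \<eta> j" "\<And>j. \<eta> j \<le> 1"
  shows "(norm (iter \<eta> (Suc j) - z))\<^sup>2 \<le> (norm (iter \<eta> j - z))\<^sup>2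
    - 2 * \<eta> j * (R (iter \<eta> j) - R z) + 25 * (R (iter \<eta> j) - R (iter \<eta> (Suc j)))"
proof -
  let ?w = "iter \<eta> j" and ?g = "grad (iter \<eta> j)"
  have "(norm (iter \<eta> (Suc j) - z))\<^sup>2 = (norm (?w - z))\<^sup>2 + 2 * \<eta> j * (?g \<bullet> (z - ?w)) + \<eta> j * \<eta> j * (norm ?g)\<^sup>2"
    by (simp add: power2_norm_eq_inner inner_diff_left inner_diff_right inner_commute algebra_simps)
  moreover have "2 * \<eta> j * (?g \<bullet> (z - ?w)) \<le> 2 * \<eta> j * (R z - R ?w)"
    using assms R_tangent by (intro mult_left_mono) auto
  moreover have "\<eta> j * \<eta> j * (norm ?g)\<^sup>2 \<le> \<eta> j * 1 * (norm ?g)\<^sup>2"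
    using assms by (intro mult_left_mono mult_right_mono) auto
  moreover have "\<eta> j * (norm ?g)\<^sup>2 \<le> 25 * (R ?w - R (iter \<eta> (Suc j)))"
    using R_iter_Suc[of \<eta> j, OF assms] by simp
  ultimately show ?thesis by (simp add: algebra_simps)
qed

text \<open>Sum of \<open>distance_step\<close> over all steps. The last risk is the smallest, so it
  may replace the earlier ones, and the total decrease is at most 1, whence the 25.\<close>

lemma risk_gap:
  assumes "\<And>j. 0 \<le> \<eta> j" "\<And>j. \<eta> j \<le> 1"
  shows "2 * (\<Sum>j<t. \<eta> j) * (R (iter \<eta> t) - R z) \<le> (norm z)\<^sup>2 + 25"
proof -
  have "(norm (iter \<eta> t - z))\<^sup>2 + 2 * (\<Sum>j<t. \<eta> j * (R (iter \<eta> j) - R z))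
      \<le> (norm z)\<^sup>2 + 25 * (R 0 - R (iter \<eta> t))"
  proof (induction t)
    case (Suc t)
    then show ?case using distance_step[of \<eta> t z, OF assms] by (simp add: algebra_simps)
  qed simp
  moreover have "(\<Sum>j<t. \<eta> j) * (R (iter \<eta> t) - R z) \<le> (\<Sum>j<t. \<eta> j * (R (iter \<eta> j) - R z))"
    unfolding sum_distrib_right using assms R_iter_antimono[of \<eta>, OF assms]
    by (intro sum_mono mult_left_mono) auto
  moreover have "R 0 - R (iter \<eta> t) \<le> 1"
    using R_0 R_nonneg[of "iter \<eta> t"] by linarith
  ultimately show ?thesis using zero_le_power2[of "norm (iter \<eta> t - z)"] by argo
qed

text \<open>\<open>risk_gap\<close> with the reference point \<open>vbar + ln t *\<^sub>R u\<close>: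
  its excess is O(1/t) and its squared norm is O(ln(t)^2). The constant is fixed before the step
  sizes.\<close>

lemma risk_rate:
  obtains K where "K \<ge> 0"
    "\<And>\<eta> t. \<lbrakk>\<And>j. 0 < \<eta> j; \<And>j. \<eta> j \<le> 1; t \<ge> 1\<rbrakk> \<Longrightarrow>
       excess (iter \<eta> t) \<le> K * (1 / real t + (ln (real t))\<^sup>2 / (\<Sum>j<t. \<eta> j))"
proof -
  obtain u where u: "\<And>i. i \<in> C \<Longrightarrow> a i \<bullet> u \<le> -1" "\<And>i. i \<notin> C \<Longrightarrow> a i \<bullet> u = 0"
    by (rule separator) blast
  \<comment> \<open>Dividing by \<open>(ln 2)\<^sup>2\<close> lets the constant terms be absorbed
    into \<open>A\<close> times the squared logarithm for \<open>t \<ge> 2\<close>.\<close>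
  define A where "A = (2 * (norm vbar)\<^sup>2 + 25) / (ln 2)\<^sup>2 + 2 * (norm u)\<^sup>2"
  define K where "K = 1 + exp (norm vbar) + A"
  have A0: "A \<ge> 0" by (simp add: A_def)
  have "excess (iter \<eta> t) \<le> K * (1 / real t + (ln (real t))\<^sup>2 / (\<Sum>j<t. \<eta> j))"
    if \<eta>: "\<And>j. 0 < \<eta> j" "\<And>j. \<eta> j \<le> 1" and t: "t \<ge> 1" for \<eta> t
  \<comment> \<open>At \<open>t = 1\<close> the logarithm vanishes and only \<open>K\<close> remains
    on the right, which covers \<open>excess 0 \<le> 1\<close>.\<close>
  proof (cases "t = 1")
    case True
    have "excess (iter \<eta> t) \<le> excess 0"
      using R_iter_antimono[of \<eta> 0 t] \<eta> by (simp add: excess_def less_imp_le)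
    also have "\<dots> \<le> K" using excess_0 A0 by (simp add: K_def add_increasing2)
    finally show ?thesis using True by simp
  next
    case False
    then have t2: "t \<ge> 2" using t by simp
    let ?L = "ln (real t)" and ?s = "\<Sum>j<t. \<eta> j"
    have L: "ln 2 \<le> ?L" "0 < ?L" using t2 by auto
    have s0: "0 < ?s" using t2 \<eta> by (intro sum_pos) (auto simp: lessThan_empty_iff)
    define z where "z = vbar + ?L *\<^sub>R u"
    have "excess z \<le> exp (norm vbar) * exp (- 1 * ?L)"
      unfolding z_def by (rule excess_along_separator[OF u]) (use L in auto)
    then have ez: "excess z \<le> exp (norm vbar) * (1 / real t)"
      using t2 by (simp add: exp_minus inverse_eq_divide)
    have "(norm z)\<^sup>2 \<le> (norm vbar + ?L * norm u)\<^sup>2"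
      unfolding z_def by (intro power_mono norm_triangle_le) (use L in auto)
    also have "\<dots> \<le> 2 * (norm vbar)\<^sup>2 + 2 * (norm u)\<^sup>2 * ?L\<^sup>2"
      using sum_squares_bound[of "norm vbar" "?L * norm u"] by (simp add: power2_sum power_mult_distrib mult.commute)
    finally have "(norm z)\<^sup>2 + 25 \<le> (2 * (norm vbar)\<^sup>2 + 25) * 1 + 2 * (norm u)\<^sup>2 * ?L\<^sup>2" by simp
    also have "\<dots> \<le> (2 * (norm vbar)\<^sup>2 + 25) * (?L\<^sup>2 / (ln 2)\<^sup>2) + 2 * (norm u)\<^sup>2 * ?L\<^sup>2"
      using power_mono[OF L(1), of 2] by (intro add_mono mult_left_mono) auto
    also have "\<dots> = A * ?L\<^sup>2" by (simp add: A_def algebra_simps add_divide_distrib)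
    finally have nz: "(norm z)\<^sup>2 + 25 \<le> A * ?L\<^sup>2" .
    have "2 * ?s * (R (iter \<eta> t) - R z) \<le> A * ?L\<^sup>2"
      using risk_gap[of \<eta> t z] \<eta> nz by (force simp: less_imp_le)
    then have "R (iter \<eta> t) - R z \<le> A / 2 * (?L\<^sup>2 / ?s)"
      using s0 by (simp add: field_simps)
    also have "\<dots> \<le> A * (?L\<^sup>2 / ?s)" using A0 s0 by (intro mult_right_mono) auto
    finally have "excess (iter \<eta> t) \<le> exp (norm vbar) * (1 / real t) + A * (?L\<^sup>2 / ?s)"
      using ez by (simp add: excess_def)
    also have "\<dots> \<le> K * (1 / real t) + K * (?L\<^sup>2 / ?s)"
      using A0 s0 by (intro add_mono mult_right_mono) (auto simp: K_def)
    finally show ?thesis by (simp add: distrib_left)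
  qed
  then show ?thesis using that[of K] A0 by (simp add: K_def)
qed

lemma excess_iter_le_1:
  assumes "\<And>j. 0 \<le> \<eta> j" "\<And>j. \<eta> j \<le> 1"
  shows "excess (iter \<eta> t) \<le> 1"
  using R_iter_le_1[of \<eta> t, OF assms] divide_nonneg_nonneg[OF LS_nonneg[of vbar] of_nat_0_le_iff[of "CARD('n)"]]
  unfolding excess_def by linarith

text \<open>Turns a lower bound \<open>q * h t\<close> on the step sums, valid from \<open>T\<close>
  on, into a rate from \<open>t = 2\<close> on, with a constant uniform over the step sizes.\<close>

lemma risk_rate_step_sums:
  fixes h :: "nat \<Rightarrow> real"
  assumes "q > 0" and h: "\<And>t. t \<ge> 2 \<Longrightarrow> 0 < h t \<and> h t \<le> real t"
  obtains K where "K \<ge> 0"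
    "\<And>\<eta> t. \<lbrakk>\<And>j. 0 < \<eta> j; \<And>j. \<eta> j \<le> 1; t \<ge> 2; t \<ge> T \<Longrightarrow> q * h t \<le> (\<Sum>j<t. \<eta> j)\<rbrakk> \<Longrightarrow>
       excess (iter \<eta> t) \<le> K * ((ln (real t))\<^sup>2 / h t)"
proof -
  obtain K where K: "K \<ge> 0"
    "\<And>\<eta> t. \<lbrakk>\<And>j. 0 < \<eta> j; \<And>j. \<eta> j \<le> 1; t \<ge> 1\<rbrakk> \<Longrightarrow>
       excess (iter \<eta> t) \<le> K * (1 / real t + (ln (real t))\<^sup>2 / (\<Sum>j<t. \<eta> j))"
    by (rule risk_rate) blast
  \<comment> \<open>The first summand serves \<open>t \<ge> T\<close>, where
    \<open>h t \<le> t\<close> absorbs the 1/t term. The second serves the earlier times: there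
    \<open>h t < T\<close>, so \<open>T / h t\<close> exceeds 1, an upper bound for the
    excess.\<close>
  define K' where "K' = K * (1 / (ln 2)\<^sup>2 + 1 / q) + real T / (ln 2)\<^sup>2"
  have K'0: "K * (1 / (ln 2)\<^sup>2 + 1 / q) \<ge> 0" using K(1) assms(1) by simp
  have "excess (iter \<eta> t) \<le> K' * ((ln (real t))\<^sup>2 / h t)"
    if \<eta>: "\<And>j. 0 < \<eta> j" "\<And>j. \<eta> j \<le> 1" and t: "t \<ge> 2"
      and s: "t \<ge> T \<Longrightarrow> q * h t \<le> (\<Sum>j<t. \<eta> j)" for \<eta> t
  proof -
    let ?L = "ln (real t)"
    have L: "ln 2 \<le> ?L" using t by simp
    have hp: "0 < h t" "h t \<le> real t" using h[OF t] by auto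
    have "1 \<le> ?L\<^sup>2 / (ln 2)\<^sup>2" using power_mono[OF L, of 2] by simp
    then have "1 / h t \<le> ?L\<^sup>2 / (ln 2)\<^sup>2 / h t"
      using hp by (intro divide_right_mono) auto
    then have hL: "1 / h t \<le> 1 / (ln 2)\<^sup>2 * (?L\<^sup>2 / h t)" by simp
    show ?thesis
    proof (cases "t \<ge> T")
      case True
      have "1 / real t \<le> 1 / h t" using hp by (simp add: frac_le)
      moreover have "?L\<^sup>2 / (\<Sum>j<t. \<eta> j) \<le> ?L\<^sup>2 / (q * h t)"
        using s[OF True] t hp assms(1)
        by (intro divide_left_mono mult_pos_pos sum_pos) (auto simp: \<eta> lessThan_empty_iff)
      moreover have "?L\<^sup>2 / (q * h t) = 1 / q * (?L\<^sup>2 / h t)" by simp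
      ultimately have "1 / real t + ?L\<^sup>2 / (\<Sum>j<t. \<eta> j) \<le> (1 / (ln 2)\<^sup>2 + 1 / q) * (?L\<^sup>2 / h t)"
        unfolding distrib_right using hL by linarith
      then have "K * (1 / real t + ?L\<^sup>2 / (\<Sum>j<t. \<eta> j)) \<le> K * ((1 / (ln 2)\<^sup>2 + 1 / q) * (?L\<^sup>2 / h t))"
        using K(1) by (rule mult_left_mono)
      also have "\<dots> = K * (1 / (ln 2)\<^sup>2 + 1 / q) * (?L\<^sup>2 / h t)" by (simp only: mult.assoc)
      also have "\<dots> \<le> K' * (?L\<^sup>2 / h t)"
        using hp by (intro mult_right_mono) (auto simp: K'_def)
      finally show ?thesis using K(2)[of \<eta> t, OF \<eta>] t by simp
    next
      case False
      then have "1 \<le> real T * (1 / h t)" using hp by simp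
      also have "\<dots> \<le> real T * (1 / (ln 2)\<^sup>2 * (?L\<^sup>2 / h t))" by (intro mult_left_mono hL) simp
      also have "\<dots> = real T / (ln 2)\<^sup>2 * (?L\<^sup>2 / h t)" by simp
      also have "\<dots> \<le> K' * (?L\<^sup>2 / h t)"
        using hp K'0 by (intro mult_right_mono) (auto simp: K'_def)
      finally show ?thesis using excess_iter_le_1[of \<eta> t] \<eta> by (force simp: less_imp_le intro: order_trans)
    qed
  qed
  moreover have "K' \<ge> 0" using K'0 by (simp add: K'_def)
  ultimately show ?thesis using that by blast
qed

section \<open>The maximum margin predictor\<close>


definition perp :: "'n \<Rightarrow> 'a" where
  "perp i = a i - orth_proj S (a i)"

lemma perp_in: "perp i \<in> S\<^sup>\<bottom>"
  unfolding perp_def by (rule diff_orth_proj_in[OF subspace_S])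

text \<open>Both orthogonality relations together say that projecting the row onto the complement
  amounts to projecting \<open>w\<close>.\<close>

lemma perp_inner: "perp i \<bullet> w = a i \<bullet> w - a i \<bullet> orth_proj S w"
proof -
  have "perp i \<bullet> orth_proj S w = 0"
    using inner_orthogonal_comp[OF orth_proj_in[OF subspace_S] perp_in] by (simp add: inner_commute)
  moreover have "orth_proj S (a i) \<bullet> (w - orth_proj S w) = 0"
    by (intro inner_orthogonal_comp[of _ S] orth_proj_in diff_orth_proj_in subspace_S)
  ultimately show ?thesis by (simp add: perp_def inner_diff_left inner_diff_right)
qed

lemma orthogonal_comp_S_I:
  assumes "\<And>i. i \<notin> C \<Longrightarrow> a i \<bullet> u = 0"
  shows "u \<in> S\<^sup>\<bottom>"
proof -
  have "orthogonal u x" if "x \<in> span (a ` (- C))" for x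
    using that by (rule orthogonal_to_span) (use assms in \<open>auto simp: orthogonal_def inner_commute\<close>)
  then show ?thesis by (simp add: orthogonal_comp_def S_def orthogonal_commute)
qed

lemma orth_proj_eq_0: "u \<in> S\<^sup>\<bottom> \<Longrightarrow> orth_proj S u = 0"
  by (rule orth_proj_eqI) (simp_all add: subspace_S subspace_0)

text \<open>A separator vanishes on the rows outside \<open>C\<close>, so it lies in the complement
  of \<open>S\<close>, where \<open>a i\<close> and \<open>perp i\<close> have the same inner
  products.\<close>

lemma perp_separable:
  obtains u where "\<And>i. i \<in> C \<Longrightarrow> perp i \<bullet> u \<le> -1"
proof -
  obtain u where u: "\<And>i. i \<in> C \<Longrightarrow> a i \<bullet> u \<le> -1" "\<And>i. i \<notin> C \<Longrightarrow> a i \<bullet> u = 0"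
    by (rule separator) blast
  then show ?thesis
    using that[of u] by (simp add: perp_inner orth_proj_eq_0 orthogonal_comp_S_I)
qed

definition dual_hull :: "'a set" where
  "dual_hull = convex hull ((\<lambda>i. - perp i) ` C)"

text \<open>The maximum margin is the distance from the origin to the convex hull of the negated rows,
  and the maximum margin predictor points to the nearest point.\<close>

definition dual_point :: 'a where
  "dual_point = closest_point dual_hull 0"

definition \<gamma> :: real where
  "\<gamma> = norm dual_point"

definition ubar :: 'a where
  "ubar = dual_point /\<^sub>R \<gamma>"

context
  assumes C_nonempty: "C \<noteq> {}"
begin

lemma compact_dual_hull: "compact dual_hull"
  unfolding dual_hull_def by (intro compact_convex_hull finite_imp_compact) simp

lemma dual_point_in: "dual_point \<in> dual_hull"
  unfolding dual_point_def
  by (rule closest_point_in_set)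
     (auto simp: compact_imp_closed compact_dual_hull, simp add: dual_hull_def C_nonempty)

lemma dual_hull_subset:
  assumes "convex T" "\<And>i. i \<in> C \<Longrightarrow> - perp i \<in> T"
  shows "dual_hull \<subseteq> T"
  unfolding dual_hull_def by (rule hull_minimal) (use assms in auto)

text \<open>The variational inequality for the nearest point of a closed convex set.\<close>

lemma dual_point_inner_ge: "y \<in> dual_hull \<Longrightarrow> \<gamma>\<^sup>2 \<le> dual_point \<bullet> y"
  using closest_point_dot[of dual_hull y 0, OF _ compact_imp_closed[OF compact_dual_hull]]
  by (simp add: convex_convex_hull[folded dual_hull_def] dual_hull_def[symmetric] dual_point_def[symmetric]
      \<gamma>_def inner_diff_right power2_norm_eq_inner) (metis convex_convex_hull dual_hull_def)

text \<open>A separator places the hull in the half-space \<open>u \<bullet> y \<ge> 1\<close>,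
  which misses the origin.\<close>

lemma \<gamma>_pos: "\<gamma> > 0"
proof -
  obtain u where u: "\<And>i. i \<in> C \<Longrightarrow> perp i \<bullet> u \<le> -1"
    by (rule perp_separable) blast
  have "dual_hull \<subseteq> {y. u \<bullet> y \<ge> 1}"
  proof (rule dual_hull_subset[OF convex_halfspace_ge])
    fix i assume "i \<in> C"
    from u[OF this] show "- perp i \<in> {y. u \<bullet> y \<ge> 1}" by (simp add: inner_commute)
  qed
  then have "dual_point \<noteq> 0" using dual_point_in by auto
  then show ?thesis by (simp add: \<gamma>_def)
qed

lemma norm_ubar: "norm ubar = 1"
  using \<gamma>_pos by (simp add: ubar_def \<gamma>_def)

lemma dual_point_eq: "dual_point = \<gamma> *\<^sub>R ubar"
  using \<gamma>_pos by (simp add: ubar_def)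

lemma ubar_in: "ubar \<in> S\<^sup>\<bottom>"
proof -
  have "dual_hull \<subseteq> S\<^sup>\<bottom>"
    by (rule dual_hull_subset)
       (auto simp: subspace_orthogonal_comp subspace_imp_convex subspace_neg perp_in)
  then show ?thesis unfolding ubar_def
    using dual_point_in by (auto intro: subspace_scale subspace_orthogonal_comp)
qed

lemma perp_ubar:
  assumes "i \<in> C"
  shows "perp i \<bullet> ubar \<le> - \<gamma>"
proof -
  have "- perp i \<in> dual_hull" unfolding dual_hull_def by (rule hull_inc) (use assms in simp)
  then have "\<gamma> * \<gamma> \<le> \<gamma> * - (perp i \<bullet> ubar)"
    using dual_point_inner_ge by (fastforce simp: dual_point_eq power2_eq_square inner_commute)
  then show ?thesis using \<gamma>_pos by (simp only: mult_le_cancel_left_pos)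
qed

lemma a_ubar: "i \<in> C \<Longrightarrow> a i \<bullet> ubar \<le> - \<gamma>"
  using perp_ubar by (simp add: perp_inner orth_proj_eq_0 ubar_in)

lemma a_ubar_0: "i \<notin> C \<Longrightarrow> a i \<bullet> ubar = 0"
  using a_in_S ubar_in by (rule inner_orthogonal_comp)

text \<open>The dual certificate: \<open>\<gamma> *\<^sub>R ubar\<close> is a convex combination of
  the negated rows, so no \<open>w\<close> can make every projected row smaller than the
  corresponding average.\<close>

lemma perp_ge: "\<exists>i\<in>C. - \<gamma> * (ubar \<bullet> w) \<le> perp i \<bullet> w"
proof (rule ccontr)
  assume "\<not> ?thesis"
  then have "dual_hull \<subseteq> {y. w \<bullet> y > \<gamma> * (ubar \<bullet> w)}"
    by (intro dual_hull_subset convex_halfspace_gt) (auto simp: inner_commute)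
  then show False using dual_point_in by (auto simp: dual_point_eq inner_commute)
qed

text \<open>By \<open>perp_ge\<close>, margin \<gamma> forces
  \<open>ubar \<bullet> v \<ge> 1\<close>, the equality case of Cauchy-Schwarz for unit
  vectors.\<close>

lemma ubar_unique:
  assumes "norm v = 1" "\<And>i. i \<in> C \<Longrightarrow> perp i \<bullet> v \<le> - \<gamma>"
  shows "v = ubar"
proof -
  obtain i where "i \<in> C" "- \<gamma> * (ubar \<bullet> v) \<le> perp i \<bullet> v" using perp_ge by blast
  then have "\<gamma> * 1 \<le> \<gamma> * (ubar \<bullet> v)" using assms(2)[of i] by simp
  then have "1 \<le> ubar \<bullet> v" using \<gamma>_pos by (simp only: mult_le_cancel_left_pos)
  then have "(norm (v - ubar))\<^sup>2 \<le> 0"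
    using assms(1) norm_ubar by (simp add: norm_eq_1 power2_norm_eq_inner inner_diff_left inner_diff_right inner_commute)
  then show ?thesis by simp
qed

text \<open>\<open>perp_ge\<close> supplies a row of \<open>C\<close>. Replacing
  \<open>perp i\<close> by \<open>a i\<close> costs only the bounded \<open>S\<close> component of
  \<open>w\<close>, after which \<open>exp_row_le_excess\<close> applies.\<close>

lemma exp_margin_le_excess:
  obtains K where "K > 0" "\<And>w. R w \<le> 1 \<Longrightarrow> exp (- \<gamma> * (ubar \<bullet> w)) \<le> K * excess w"
proof -
  obtain B where B: "B \<ge> 0" "\<And>v. \<lbrakk>v \<in> S; LS v \<le> real CARD('n)\<rbrakk> \<Longrightarrow> norm v \<le> B"
    by (rule LS_coercive) blast
  have "exp (- \<gamma> * (ubar \<bullet> w)) \<le> exp B * (real CARD('n) * exp (real CARD('n))) * excess w"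
    if w: "R w \<le> 1" for w
  proof -
    obtain i where i: "i \<in> C" "- \<gamma> * (ubar \<bullet> w) \<le> perp i \<bullet> w" using perp_ge by blast
    have "norm (orth_proj S w) \<le> B"
      using B(2)[OF orth_proj_in[OF subspace_S]] LS_le_N[OF w] by (simp add: LS_orth_proj)
    then have "perp i \<bullet> w \<le> B + a i \<bullet> w"
      using abs_inner_a[of i "orth_proj S w"] by (simp add: perp_inner)
    then have "exp (- \<gamma> * (ubar \<bullet> w)) \<le> exp (B + a i \<bullet> w)" using i(2) by simp
    also have "\<dots> \<le> exp B * (real CARD('n) * exp (real CARD('n)) * excess w)"
      unfolding exp_add by (intro mult_left_mono exp_row_le_excess i w) simp
    finally show ?thesis by (simp add: mult.assoc)
  qed
  then show ?thesis using that[of "exp B * (real CARD('n) * exp (real CARD('n)))"] by simp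
qed

section \<open>Behaviour along \<open>ubar\<close> and the constrained optimum\<close>

lemma ubar_inner_vbar: "ubar \<bullet> vbar = 0"
  using inner_orthogonal_comp[OF vbar_in ubar_in] by (simp add: inner_commute)

lemma excess_along_ubar: "s \<ge> 0 \<Longrightarrow> excess (vbar + s *\<^sub>R ubar) \<le> exp (norm vbar) * exp (- \<gamma> * s)"
  by (rule excess_along_separator[OF a_ubar a_ubar_0])

lemma ubar_inner_grad: "ubar \<bullet> grad w < 0"
proof -
  have "(\<Sum>i\<in>UNIV. ell' (a i \<bullet> w) * (a i \<bullet> ubar)) < 0"
  proof -
    obtain i where i: "i \<in> C" using C_nonempty by blast
    have nonpos: "ell' (a k \<bullet> w) * (a k \<bullet> ubar) \<le> 0" for k
      using a_ubar[of k] a_ubar_0[of k] \<gamma>_pos less_imp_le[OF ell'_pos]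
      by (cases "k \<in> C") (auto intro: mult_nonneg_nonpos)
    have "a i \<bullet> ubar < 0" using a_ubar[OF i] \<gamma>_pos by linarith
    then have "ell' (a i \<bullet> w) * (a i \<bullet> ubar) < 0" using ell'_pos by (simp add: mult_pos_neg)
    then show ?thesis
      using sum_strict_mono_ex1[of UNIV "\<lambda>k. ell' (a k \<bullet> w) * (a k \<bullet> ubar)" "\<lambda>_. 0"] nonpos by auto
  qed
  then show ?thesis
    by (simp add: grad_def inner_sum_right inner_commute divide_less_0_iff mult.commute)
qed

lemma ubar_inner_iter_pos:
  assumes "\<And>j. 0 < \<eta> j"
  shows "0 < ubar \<bullet> iter \<eta> (Suc t)"
proof -
  have "ubar \<bullet> iter \<eta> t < ubar \<bullet> iter \<eta> (Suc t)" for t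
    using ubar_inner_grad[of "iter \<eta> t"] assms[of t] by (simp add: inner_diff_right mult_pos_neg)
  then have "strict_mono (\<lambda>t. ubar \<bullet> iter \<eta> t)" by (simp add: strict_mono_Suc_iff)
  from strict_monoD[OF this, of 0 "Suc t"] show ?thesis by simp
qed

text \<open>Comparing the optimum with \<open>vbar + (r - norm vbar) *\<^sub>R ubar\<close> gives
  \<open>ubar \<bullet> w \<ge> r - c\<close>. As \<open>norm w \<le> r\<close>, the cosine of the
  angle to \<open>ubar\<close> is then at least \<open>1 - c / r\<close>.\<close>

lemma constrained_direction:
  obtains K where "K \<ge> 0"
    "\<And>r w. \<lbrakk>r > 0; norm w \<le> r; \<And>v. norm v \<le> r \<Longrightarrow> R w \<le> R v\<rbrakk> \<Longrightarrow>
      (norm (w /\<^sub>R norm w - ubar))\<^sup>2 \<le> K / r"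
proof -
  obtain K where K: "K > 0" "\<And>w. R w \<le> 1 \<Longrightarrow> exp (- \<gamma> * (ubar \<bullet> w)) \<le> K * excess w"
    by (rule exp_margin_le_excess) blast
  \<comment> \<open>The part \<open>2 * norm vbar\<close> settles radii below
    \<open>norm vbar\<close>, where \<open>ubar \<bullet> w \<ge> - r\<close> is enough; the rest
    comes from taking logarithms.\<close>
  define c where "c = 2 * norm vbar + \<bar>ln K + norm vbar\<bar> / \<gamma>"
  have c0: "c \<ge> 0" using \<gamma>_pos by (simp add: c_def)
  have "(norm (w /\<^sub>R norm w - ubar))\<^sup>2 \<le> 4 * c / r"
    if r: "r > 0" and w: "norm w \<le> r" and min: "\<And>v. norm v \<le> r \<Longrightarrow> R w \<le> R v" for r w
  proof -
    have "r - c \<le> ubar \<bullet> w"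
    proof (cases "r \<ge> norm vbar")
      case False
      have "\<bar>ubar \<bullet> w\<bar> \<le> r"
        using Cauchy_Schwarz_ineq2[of ubar w] w by (simp add: norm_ubar)
      moreover have "0 \<le> \<bar>ln K + norm vbar\<bar> / \<gamma>" using \<gamma>_pos by simp
      ultimately show ?thesis using False unfolding c_def by linarith
    next
      case True
      let ?z = "vbar + (r - norm vbar) *\<^sub>R ubar"
      have "norm ?z \<le> r" using True norm_triangle_ineq[of vbar "(r - norm vbar) *\<^sub>R ubar"] by (simp add: norm_ubar)
      then have "excess w \<le> excess ?z" using min by (simp add: excess_def)
      also have "\<dots> \<le> exp (norm vbar) * exp (- \<gamma> * (r - norm vbar))"
        by (rule excess_along_ubar) (use True in simp)
      finally have "K * excess w \<le> K * (exp (norm vbar) * exp (- \<gamma> * (r - norm vbar)))"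
        using K(1) by simp
      moreover have "R w \<le> 1" using min[of 0] r R_0 by simp
      ultimately have "exp (- \<gamma> * (ubar \<bullet> w)) \<le> K * (exp (norm vbar) * exp (- \<gamma> * (r - norm vbar)))"
        using K(2) order_trans by blast
      also have "\<dots> = exp (ln K + norm vbar + - \<gamma> * (r - norm vbar))"
        by (simp only: exp_add exp_ln[OF K(1)] mult.assoc)
      finally have "- \<gamma> * (ubar \<bullet> w) \<le> ln K + norm vbar - \<gamma> * (r - norm vbar)" by simp
      then have "\<gamma> * (r - norm vbar - (ln K + norm vbar) / \<gamma>) \<le> \<gamma> * (ubar \<bullet> w)"
        using \<gamma>_pos by (simp add: right_diff_distrib)
      then have "r - norm vbar - (ln K + norm vbar) / \<gamma> \<le> ubar \<bullet> w"
        using \<gamma>_pos by (simp only: mult_le_cancel_left_pos)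
      moreover have "(ln K + norm vbar) / \<gamma> \<le> \<bar>ln K + norm vbar\<bar> / \<gamma>"
        using \<gamma>_pos by (simp add: divide_right_mono)
      ultimately show ?thesis unfolding c_def using norm_ge_zero[of vbar] by linarith
    qed
    note lower = this
    show ?thesis
    \<comment> \<open>For small radii the bound is trivial: vectors of norm at most 1 are at
      distance at most 2.\<close>
    proof (cases "r \<le> c")
      case True
      have "norm (w /\<^sub>R norm w - ubar) \<le> norm (w /\<^sub>R norm w) + norm ubar" by (rule norm_triangle_ineq4)
      also have "\<dots> \<le> 2" by (cases "w = 0") (simp_all add: norm_ubar)
      finally have "(norm (w /\<^sub>R norm w - ubar))\<^sup>2 \<le> 2\<^sup>2" by (rule power_mono) simp
      also have "\<dots> \<le> 4 * c / r" using True r by (simp add: field_simps)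
      finally show ?thesis .
    next
      case False
      then have pos: "0 < ubar \<bullet> w" using lower by linarith
      then have nw: "norm w > 0" by auto
      have "1 - c / r = (r - c) / r" using r by (simp add: diff_divide_distrib)
      also have "\<dots> \<le> (ubar \<bullet> w) / r" using lower r by (simp add: divide_right_mono)
      also have "\<dots> \<le> (ubar \<bullet> w) / norm w" using pos w nw r by (intro divide_left_mono) auto
      finally have *: "1 - c / r \<le> (ubar \<bullet> w) / norm w" .
      have "(norm (w /\<^sub>R norm w - ubar))\<^sup>2 = (norm (w /\<^sub>R norm w))\<^sup>2 + (norm ubar)\<^sup>2 - 2 * ((ubar \<bullet> w) / norm w)"
        unfolding power2_norm_eq_inner
        by (simp only: inner_diff_left inner_diff_right inner_commute) (simp add: inner_commute divide_inverse_commute)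
      also have "\<dots> = 2 - 2 * ((ubar \<bullet> w) / norm w)" using nw by (simp add: norm_ubar)
      also have "\<dots> \<le> 4 * c / r" unfolding times_divide_eq_right[symmetric]
        using * divide_nonneg_pos[OF c0 r] by linarith
      finally show ?thesis .
    qed
  qed
  then show ?thesis using that[of "4 * c"] c0 by simp
qed

end

end

section \<open>Implicit bias\<close>

text \<open>After scaling by \<open>s\<close>, pass through \<open>w\<close>: rescaling
  \<open>w\<close> to length \<open>s\<close> moves it by \<open>\<bar>s - norm w\<bar>\<close>,
  which is again at most \<open>norm (w - s *\<^sub>R u)\<close>. For \<open>w = 0\<close> the
  quotient is 0 and the bound reads \<open>1 \<le> 2\<close>.\<close>

lemma norm_normalized_diff_le:
  fixes w u :: "'a::real_normed_vector"
  assumes "s > 0" "norm u = 1"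
  shows "norm (w /\<^sub>R norm w - u) \<le> 2 * norm (w - s *\<^sub>R u) / s"
proof (cases "w = 0")
  case True
  then show ?thesis using assms by simp
next
  case False
  have "norm ((s / norm w) *\<^sub>R w - w) = norm ((s / norm w - 1) *\<^sub>R w)"
    by (simp add: scaleR_diff_left)
  also have "\<dots> = \<bar>s - norm w\<bar>"
    unfolding norm_scaleR abs_mult_pos[OF norm_ge_zero, symmetric] using False by (simp add: field_simps)
  also have "\<dots> \<le> norm (w - s *\<^sub>R u)"
    using norm_triangle_ineq3[of w "s *\<^sub>R u"] assms by (simp add: abs_minus_commute)
  finally have 1: "norm ((s / norm w) *\<^sub>R w - w) \<le> norm (w - s *\<^sub>R u)" .
  have "s * norm (w /\<^sub>R norm w - u) = norm (s *\<^sub>R (w /\<^sub>R norm w - u))"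
    using assms by simp
  also have "s *\<^sub>R (w /\<^sub>R norm w - u) = ((s / norm w) *\<^sub>R w - w) + (w - s *\<^sub>R u)"
    by (simp add: scaleR_diff_right divide_inverse)
  also have "norm \<dots> \<le> norm ((s / norm w) *\<^sub>R w - w) + norm (w - s *\<^sub>R u)"
    by (rule norm_triangle_ineq)
  finally have "s * norm (w /\<^sub>R norm w - u) \<le> 2 * norm (w - s *\<^sub>R u)" using 1 by linarith
  then show ?thesis using assms by (simp add: field_simps)
qed

lemma sum_inverse_sqrt_ge: "sqrt (real t) \<le> (\<Sum>j<t. 1 / sqrt (real j + 1))"
proof (cases "t = 0")
  case False
  have "sqrt (real t) = (\<Sum>j<t. 1 / sqrt (real t))" using False by (simp add: real_div_sqrt)
  also have "\<dots> \<le> (\<Sum>j<t. 1 / sqrt (real j + 1))"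
    by (intro sum_mono divide_left_mono) (auto intro!: mult_pos_pos)
  finally show ?thesis .
qed simp

lemma ln_ge_1: "3 \<le> t \<Longrightarrow> 1 < ln (real t)"
  using ln3_gt_1 by (rule less_le_trans) simp

lemma ln_ln_3_pos: "0 < ln (ln (3::real))"
  using ln3_gt_1 by simp

lemma ln_ln_ge: "3 \<le> t \<Longrightarrow> ln (ln 3) \<le> ln (ln (real t))"
  using ln_ge_1[of t] ln3_gt_1 by (subst ln_le_cancel_iff) auto

lemma eventually_ln_ln_le:
  "eventually (\<lambda>t::nat. 2 * ln (ln (real t)) + b \<le> ln (real t) / 4) sequentially"
  by real_asymp

context linear_erm
begin

abbreviation \<eta>s :: "nat \<Rightarrow> real" where
  "\<eta>s \<equiv> \<lambda>j. 1 / sqrt (real j + 1)"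

abbreviation ws :: "nat \<Rightarrow> 'a" where
  "ws \<equiv> iter \<eta>s"

lemma \<eta>s: "0 < \<eta>s j" "\<eta>s j \<le> 1" by simp_all

lemma R_ws_le_1: "R (ws t) \<le> 1"
  by (rule R_iter_le_1) (auto simp: \<eta>s less_imp_le)

lemma excess_ws:
  obtains K where "K \<ge> 0" "\<And>t. t \<ge> 2 \<Longrightarrow> excess (ws t) \<le> K * ((ln (real t))\<^sup>2 / sqrt (real t))"
proof -
  obtain K where K: "K \<ge> 0"
    "\<And>\<eta> t. \<lbrakk>\<And>j. 0 < \<eta> j; \<And>j. \<eta> j \<le> 1; t \<ge> 2; t \<ge> 0 \<Longrightarrow> 1 * sqrt (real t) \<le> (\<Sum>j<t. \<eta> j)\<rbrakk> \<Longrightarrow>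
       excess (iter \<eta> t) \<le> K * ((ln (real t))\<^sup>2 / sqrt (real t))"
    by (rule risk_rate_step_sums[of 1 "\<lambda>t. sqrt (real t)" 0]) (auto intro!: real_le_lsqrt self_le_power)
  show ?thesis
    by (rule that[OF K(1)], rule K(2)) (use sum_inverse_sqrt_ge in auto)
qed

text \<open>Stated for every \<open>v\<close> of no larger risk, so that it covers the iterate and
  also the constrained optimum, for which the iterate is a competitor.\<close>

lemma proj_ws_rate:
  obtains K where "K \<ge> 0"
    "\<And>t v. \<lbrakk>t \<ge> 2; R v \<le> R (ws t)\<rbrakk> \<Longrightarrow>
      (norm (orth_proj S v - vbar))\<^sup>2 \<le> K * ((ln (real t))\<^sup>2 / sqrt (real t))"
proof -
  obtain K where K: "K \<ge> 0" "\<And>t. t \<ge> 2 \<Longrightarrow> excess (ws t) \<le> K * ((ln (real t))\<^sup>2 / sqrt (real t))"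
    by (rule excess_ws) blast
  obtain \<kappa> where \<kappa>: "\<kappa> > 0" "\<And>w. R w \<le> 1 \<Longrightarrow> \<kappa> * (norm (orth_proj S w - vbar))\<^sup>2 \<le> excess w"
    by (rule proj_growth) blast
  have "(norm (orth_proj S v - vbar))\<^sup>2 \<le> K / \<kappa> * ((ln (real t))\<^sup>2 / sqrt (real t))"
    if "t \<ge> 2" "R v \<le> R (ws t)" for t v
  proof -
    have "\<kappa> * (norm (orth_proj S v - vbar))\<^sup>2 \<le> K * ((ln (real t))\<^sup>2 / sqrt (real t))"
      using \<kappa>(2)[of v] K(2)[OF that(1)] that(2) R_ws_le_1[of t] by (simp add: excess_def)
    then show ?thesis
      by (simp only: times_divide_eq_left pos_le_divide_eq[OF \<kappa>(1)] mult.commute)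
  qed
  then show ?thesis using that[of "K / \<kappa>"] K(1) \<kappa>(1) by simp
qed

context
  assumes C_nonempty: "C \<noteq> {}"
begin

text \<open>Chosen so that \<open>exp (- \<gamma> * target t)\<close> equals
  \<open>1 / sqrt t\<close>; multiplied by the step size this is O(1/t), whose sums are
  logarithmic.\<close>

definition target :: "nat \<Rightarrow> real" where
  "target t = ln (real t) / (2 * \<gamma>)"

text \<open>Logarithm of \<open>exp_margin_le_excess\<close> combined with the risk rate; the
  iterated logarithm stems from the factor ln(t)^2.\<close>

lemma margin_ws:
  obtains c where "c \<ge> 0"
    "\<And>t. t \<ge> 2 \<Longrightarrow> target t - (2 / \<gamma> * ln (ln (real t)) + c) \<le> ubar \<bullet> ws t"
proof -
  note \<gamma>_pos = \<gamma>_pos[OF C_nonempty]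
  obtain K where K: "K \<ge> 0" "\<And>t. t \<ge> 2 \<Longrightarrow> excess (ws t) \<le> K * ((ln (real t))\<^sup>2 / sqrt (real t))"
    by (rule excess_ws) blast
  obtain K' where K': "K' > 0" "\<And>w. R w \<le> 1 \<Longrightarrow> exp (- \<gamma> * (ubar \<bullet> w)) \<le> K' * excess w"
    by (rule exp_margin_le_excess[OF C_nonempty]) blast
  \<comment> \<open>\<open>K + 1\<close> rather than \<open>K\<close> makes \<open>Q\<close>
    positive, so that \<open>ln Q\<close> can be exponentiated back.\<close>
  define Q where "Q = K' * (K + 1)"
  have Q: "Q > 0" using K K' by (simp add: Q_def)
  have "target t - (2 / \<gamma> * ln (ln (real t)) + \<bar>ln Q\<bar> / \<gamma>) \<le> ubar \<bullet> ws t" if t: "t \<ge> 2" for t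
  proof -
    let ?L = "ln (real t)"
    have L: "?L > 0" using t by simp
    have "exp (- \<gamma> * (ubar \<bullet> ws t)) \<le> K' * excess (ws t)" by (rule K'(2)[OF R_ws_le_1])
    also have "\<dots> \<le> K' * ((K + 1) * (?L\<^sup>2 / sqrt (real t)))"
      using K'(1) L t by (intro mult_left_mono order_trans[OF K(2)[OF t]] mult_right_mono) auto
    also have "\<dots> = exp (ln Q + (2 * ln ?L - ?L / 2))"
    proof -
      have "exp (2 * ln ?L) = ?L\<^sup>2" using L by (simp only: mult_2 exp_add exp_ln power2_eq_square)
      moreover have "exp (?L / 2) = sqrt (real t)"
        using t exp_ln[of "sqrt (real t)"] by (simp add: ln_sqrt)
      ultimately show ?thesis using Q by (simp add: exp_add exp_diff Q_def)
    qed
    finally have "- \<gamma> * (ubar \<bullet> ws t) \<le> ln Q + (2 * ln ?L - ?L / 2)" by simp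
    then have "?L / 2 - 2 * ln ?L - \<bar>ln Q\<bar> \<le> \<gamma> * (ubar \<bullet> ws t)" by simp
    also have "?L / 2 - 2 * ln ?L - \<bar>ln Q\<bar> = \<gamma> * (target t - (2 / \<gamma> * ln ?L + \<bar>ln Q\<bar> / \<gamma>))"
      using \<gamma>_pos by (simp add: target_def field_simps)
    finally show ?thesis using \<gamma>_pos by (simp only: mult_le_cancel_left_pos)
  qed
  then show ?thesis using that[of "\<bar>ln Q\<bar> / \<gamma>"] \<gamma>_pos by simp
qed

text \<open>The reference point moves along with the iterates.  Moving it by \<open>\<delta>\<close> in direction \<open>ubar\<close> increases
  the squared distance by at most \<open>2 * \<delta> * E\<close>, where \<open>E\<close> is the slack in \<open>margin_ws\<close>; by the choice of
  \<open>target\<close>, the excess risk of the reference point contributes only \<open>O(1 / t)\<close> in step \<open>t\<close>.\<close>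

lemma distance_to_target:
  obtains K where "K \<ge> 0"
    "\<And>t. t \<ge> 3 \<Longrightarrow> (norm (ws t - target t *\<^sub>R ubar))\<^sup>2 \<le> K * (ln (real t) * ln (ln (real t)))"
proof -
  note \<gamma>_pos = \<gamma>_pos[OF C_nonempty]
  note norm_ubar = norm_ubar[OF C_nonempty]
  note orth = ubar_inner_vbar[OF C_nonempty]
  obtain c where c: "c \<ge> 0"
    "\<And>t. t \<ge> 2 \<Longrightarrow> target t - (2 / \<gamma> * ln (ln (real t)) + c) \<le> ubar \<bullet> ws t"
    by (rule margin_ws) blast
  define E where "E t = 2 / \<gamma> * ln (ln (real t)) + c" for t :: nat
  define z where "z t = vbar + target t *\<^sub>R ubar" for t
  define D where "D t = (norm (ws t - z t))\<^sup>2" for t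
  define A where "A = 4 * exp (norm vbar)"
  \<comment> \<open>Lets the O(1/t) errors telescope into a logarithm.\<close>
  have ln_step: "1 / (real t + 1) \<le> ln (real (Suc t)) - ln (real t)" if "t \<ge> 3" for t
  proof -
    have "ln (real t / real (Suc t)) \<le> real t / real (Suc t) - 1"
      by (rule ln_le_minus_one) (use that in simp)
    moreover have "ln (real t / real (Suc t)) = ln (real t) - ln (real (Suc t))"
      using that by (simp add: ln_div del: of_nat_Suc)
    moreover have "real t / real (Suc t) - 1 = - 1 / (real t + 1)" by (simp add: field_simps)
    ultimately show ?thesis by simp
  qed
  have D_step: "D (Suc t) \<le> D t + A * (ln (real (Suc t)) - ln (real t)) + 25 * (R (ws t) - R (ws (Suc t)))
      + 2 * (target (Suc t) - target t) * E (Suc t)" if t: "t \<ge> 3" for t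
  proof -
    define \<delta> where "\<delta> = target (Suc t) - target t"
    have "ln (real t) \<le> ln (real (Suc t))" using t by simp
    then have \<delta>: "\<delta> \<ge> 0" unfolding \<delta>_def target_def using \<gamma>_pos by (simp add: divide_right_mono)
    have "excess (z t) \<le> exp (norm vbar) * exp (- \<gamma> * target t)"
      unfolding z_def by (rule excess_along_ubar[OF C_nonempty]) (use t \<gamma>_pos in \<open>simp add: target_def\<close>)
    also have "- \<gamma> * target t = - ln (sqrt (real t))" using \<gamma>_pos t by (simp add: target_def ln_sqrt)
    also have "exp (norm vbar) * exp (- ln (sqrt (real t))) = exp (norm vbar) / sqrt (real t)"
      using t by (simp add: exp_minus divide_inverse)
    finally have ez: "excess (z t) \<le> exp (norm vbar) / sqrt (real t)" .
    have "2 * \<eta>s t * (R (z t) - R (ws t)) \<le> 2 * \<eta>s t * excess (z t)"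
      using excess_nonneg[of "ws t"] by (intro mult_left_mono) (auto simp: excess_def)
    also have "\<dots> \<le> 2 * \<eta>s t * (exp (norm vbar) / sqrt (real t))"
      using ez by (intro mult_left_mono) auto
    also have "\<dots> = 2 * exp (norm vbar) * (1 / (sqrt (real t + 1) * sqrt (real t)))" by simp
    also have "\<dots> \<le> 2 * exp (norm vbar) * (2 / (real t + 1))"
    proof (intro mult_left_mono)
      have "(real t + 1) / 2 \<le> sqrt (real t) * sqrt (real t)" using t by simp
      also have "\<dots> \<le> sqrt (real t + 1) * sqrt (real t)" by (intro mult_right_mono) auto
      finally show "1 / (sqrt (real t + 1) * sqrt (real t)) \<le> 2 / (real t + 1)"
        using t by (simp add: field_simps)
    qed simp
    also have "\<dots> = A * (1 / (real t + 1))" by (simp add: A_def)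
    also have "\<dots> \<le> A * (ln (real (Suc t)) - ln (real t))"
      by (intro mult_left_mono ln_step t) (simp add: A_def)
    finally have risk: "2 * \<eta>s t * (R (z t) - R (ws t)) \<le> A * (ln (real (Suc t)) - ln (real t))" .
    have "(norm (ws (Suc t) - z t))\<^sup>2 \<le> D t
        - 2 * \<eta>s t * (R (ws t) - R (z t)) + 25 * (R (ws t) - R (ws (Suc t)))"
      unfolding D_def by (rule distance_step) (auto simp: \<eta>s less_imp_le)
    then have old: "(norm (ws (Suc t) - z t))\<^sup>2 \<le> D t
        + A * (ln (real (Suc t)) - ln (real t)) + 25 * (R (ws t) - R (ws (Suc t)))"
      using risk by (simp add: algebra_simps del: iter.simps)
    have "z (Suc t) = z t + \<delta> *\<^sub>R ubar" by (simp add: z_def \<delta>_def scaleR_diff_left)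
    then have "D (Suc t) = (norm (ws (Suc t) - z t))\<^sup>2 - 2 * \<delta> * (ubar \<bullet> (ws (Suc t) - z t)) + \<delta>\<^sup>2 * (norm ubar)\<^sup>2"
      unfolding D_def power2_norm_eq_inner
      by (simp add: inner_diff_left inner_diff_right inner_add_left inner_add_right inner_commute
          algebra_simps power2_eq_square del: iter.simps)
    also have "ubar \<bullet> (ws (Suc t) - z t) = ubar \<bullet> ws (Suc t) - target t"
      using norm_ubar orth by (simp add: z_def inner_diff_right inner_add_right norm_eq_1 del: iter.simps)
    finally have "D (Suc t) = (norm (ws (Suc t) - z t))\<^sup>2 - 2 * \<delta> * (ubar \<bullet> ws (Suc t) - target t) + \<delta>\<^sup>2"
      using norm_ubar by simp
    \<comment> \<open>The new margin falls short of the new target by at most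
      \<open>E (Suc t)\<close>. The resulting \<open>- 2 * \<delta>\<^sup>2\<close> outweighs the
      \<open>\<delta>\<^sup>2\<close> from the expansion, leaving only the
      \<open>\<delta> * E\<close> term.\<close>
    moreover have "2 * \<delta> * (\<delta> - E (Suc t)) \<le> 2 * \<delta> * (ubar \<bullet> ws (Suc t) - target t)"
      using c(2)[of "Suc t"] t \<delta> by (intro mult_left_mono) (simp_all add: \<delta>_def E_def del: iter.simps)
    moreover have "2 * \<delta> * (\<delta> - E (Suc t)) = 2 * \<delta>\<^sup>2 - 2 * \<delta> * E (Suc t)"
      by (simp add: power2_eq_square algebra_simps)
    moreover have "0 \<le> \<delta>\<^sup>2" by simp
    ultimately show ?thesis using old unfolding \<delta>_def by linarith
  qed
  have E_mono: "E t \<le> E (Suc t)" if "t \<ge> 3" for t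
  proof -
    have "ln (real t) \<le> ln (real (Suc t))" using that by simp
    then have "ln (ln (real t)) \<le> ln (ln (real (Suc t)))"
      using ln_ge_1[OF that] by (subst ln_le_cancel_iff) linarith+
    then show ?thesis using \<gamma>_pos by (simp add: E_def divide_right_mono del: of_nat_Suc)
  qed
  have target_mono: "target 3 \<le> target t" if "t \<ge> 3" for t
    using that \<gamma>_pos by (simp add: target_def divide_right_mono)
  \<comment> \<open>As \<open>E\<close> increases, its last value bounds all earlier ones, and the
    increments of \<open>target\<close> telescope.\<close>
  have total: "D t \<le> D 3 + A * (ln (real t) - ln 3) + 25 * (R (ws 3) - R (ws t)) + 2 * (target t - target 3) * E t"
    if "t \<ge> 3" for t
    using that
  proof (induction rule: dec_induct)
    case (step m)
    have "2 * (target m - target 3) * E m \<le> 2 * (target m - target 3) * E (Suc m)"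
      using target_mono E_mono step by (intro mult_left_mono) auto
    then show ?case using step.IH D_step[OF \<open>3 \<le> m\<close>] by argo
  qed simp
  \<comment> \<open>The least value of ln ln t for \<open>t \<ge> 3\<close>; dividing by it absorbs
    constants and single logarithms into \<open>M\<close>.\<close>
  define q where "q = ln (ln (3::real))"
  have q: "q > 0" unfolding q_def by (rule ln_ln_3_pos)
  define K where "K = 2 * ((D 3 + A + 25 + c / \<gamma>) / q + 2 / \<gamma>\<^sup>2) + 2 * (norm vbar)\<^sup>2 / q"
  have "(norm (ws t - target t *\<^sub>R ubar))\<^sup>2 \<le> K * (ln (real t) * ln (ln (real t)))" if t: "t \<ge> 3" for t
  proof -
    define L where "L = ln (real t)"
    define M where "M = L * ln L"
    have L: "1 < L" unfolding L_def by (rule ln_ge_1[OF t])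
    have "q \<le> ln L" unfolding L_def q_def by (rule ln_ln_ge[OF t])
    then have "L * q \<le> M" unfolding M_def using L by (intro mult_left_mono) auto
    then have LM: "L \<le> M / q" using q by (simp add: field_simps)
    then have M1: "1 \<le> M / q" using L by linarith
    have E0: "0 \<le> E t" unfolding E_def using c(1) \<gamma>_pos \<open>q \<le> ln L\<close> q by (simp add: L_def)
    have "2 * (target t - target 3) * E t \<le> 2 * target t * E t"
      using E0 \<gamma>_pos by (intro mult_right_mono) (simp_all add: target_def)
    also have "\<dots> = 2 / \<gamma>\<^sup>2 * M + c / \<gamma> * L"
      using \<gamma>_pos by (simp add: target_def E_def M_def L_def field_simps power2_eq_square)
    also have "\<dots> \<le> 2 / \<gamma>\<^sup>2 * M + c / \<gamma> * (M / q)"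
      using LM c(1) \<gamma>_pos by (intro add_left_mono mult_left_mono) auto
    finally have 1: "2 * (target t - target 3) * E t \<le> 2 / \<gamma>\<^sup>2 * M + c / \<gamma> * (M / q)" .
    have "A * (ln (real t) - ln 3) \<le> A * (M / q)"
      using LM ln3_gt_1 by (intro mult_left_mono) (auto simp: A_def L_def)
    moreover have "D 3 * 1 \<le> D 3 * (M / q)" using M1 by (intro mult_left_mono) (auto simp: D_def)
    moreover have "25 * (R (ws 3) - R (ws t)) \<le> 25 * (M / q)"
      using R_ws_le_1[of 3] R_nonneg[of "ws t"] M1 by argo
    ultimately have "D t \<le> D 3 * (M / q) + A * (M / q) + 25 * (M / q) + (2 / \<gamma>\<^sup>2 * M + c / \<gamma> * (M / q))"
      using total[OF t] 1 by linarith
    also have "\<dots> = ((D 3 + A + 25 + c / \<gamma>) / q + 2 / \<gamma>\<^sup>2) * M"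
      by (simp add: distrib_right add_divide_distrib)
    finally have Dt: "D t \<le> ((D 3 + A + 25 + c / \<gamma>) / q + 2 / \<gamma>\<^sup>2) * M" .
    have "ws t - target t *\<^sub>R ubar = (ws t - z t) + vbar" by (simp add: z_def)
    then have "(norm (ws t - target t *\<^sub>R ubar))\<^sup>2 \<le> (norm (ws t - z t) + norm vbar)\<^sup>2"
      by (metis norm_triangle_ineq norm_ge_zero power_mono)
    also have "\<dots> \<le> 2 * D t + 2 * (norm vbar)\<^sup>2 * 1"
      using sum_squares_bound[of "norm (ws t - z t)" "norm vbar"] by (simp add: D_def power2_sum)
    also have "\<dots> \<le> 2 * (((D 3 + A + 25 + c / \<gamma>) / q + 2 / \<gamma>\<^sup>2) * M) + 2 * (norm vbar)\<^sup>2 * (M / q)"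
      using Dt M1 by (intro add_mono mult_left_mono) auto
    also have "\<dots> = K * M" by (simp add: K_def distrib_right)
    finally show ?thesis by (simp add: M_def L_def)
  qed
  moreover have "K \<ge> 0" using q c(1) \<gamma>_pos by (simp add: K_def A_def D_def)
  ultimately show ?thesis using that by blast
qed

text \<open>The squared distance to \<open>target t *\<^sub>R ubar\<close> is divided by the square
  of \<open>target t\<close>, which is of order ln(t)^2. The norm bound uses
  \<open>ln L \<le> L\<close> for \<open>L = ln t\<close>.\<close>

lemma direction_ws_rate:
  obtains K where "K \<ge> 0"
    "\<And>t. t \<ge> 3 \<Longrightarrow> (norm (ws t /\<^sub>R norm (ws t) - ubar))\<^sup>2 \<le> K * (ln (ln (real t)) / ln (real t))"
    "\<And>t. t \<ge> 3 \<Longrightarrow> norm (ws t) \<le> K * ln (real t)"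
proof -
  note \<gamma>_pos = \<gamma>_pos[OF C_nonempty]
  note norm_ubar = norm_ubar[OF C_nonempty]
  obtain K where K: "K \<ge> 0"
    "\<And>t. t \<ge> 3 \<Longrightarrow> (norm (ws t - target t *\<^sub>R ubar))\<^sup>2 \<le> K * (ln (real t) * ln (ln (real t)))"
    by (rule distance_to_target) blast
  define K' where "K' = 16 * \<gamma>\<^sup>2 * K + (sqrt K + 1 / (2 * \<gamma>))"
  have "(norm (ws t /\<^sub>R norm (ws t) - ubar))\<^sup>2 \<le> K' * (ln (ln (real t)) / ln (real t))
      \<and> norm (ws t) \<le> K' * ln (real t)" if t: "t \<ge> 3" for t
  proof -
    define L where "L = ln (real t)"
    have L: "1 < L" unfolding L_def by (rule ln_ge_1[OF t])
    have LL: "0 < ln L" "ln L \<le> L" using L ln_le_minus_one[of L] by simp_all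
    have s: "target t = L / (2 * \<gamma>)" "0 < target t" using L \<gamma>_pos by (simp_all add: target_def L_def)
    have d: "(norm (ws t - target t *\<^sub>R ubar))\<^sup>2 \<le> K * (L * ln L)" using K(2)[OF t] by (simp add: L_def)
    have "(norm (ws t /\<^sub>R norm (ws t) - ubar))\<^sup>2 \<le> (2 * norm (ws t - target t *\<^sub>R ubar) / target t)\<^sup>2"
      by (intro power_mono norm_normalized_diff_le s norm_ubar) simp
    also have "\<dots> = 4 / (target t)\<^sup>2 * (norm (ws t - target t *\<^sub>R ubar))\<^sup>2"
      by (simp add: power_divide power_mult_distrib)
    also have "\<dots> \<le> 4 / (target t)\<^sup>2 * (K * (L * ln L))" using d by (intro mult_left_mono) auto
    also have "\<dots> = 16 * \<gamma>\<^sup>2 * K * (ln L / L)"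
      using L \<gamma>_pos by (simp add: s(1) field_simps power2_eq_square)
    also have "\<dots> \<le> K' * (ln L / L)"
      using L LL K(1) \<gamma>_pos by (intro mult_right_mono) (auto simp: K'_def)
    finally have 1: "(norm (ws t /\<^sub>R norm (ws t) - ubar))\<^sup>2 \<le> K' * (ln L / L)" .
    have "K * (L * ln L) \<le> (sqrt K * L)\<^sup>2"
      unfolding power_mult_distrib real_sqrt_pow2[OF K(1)]
      unfolding power2_eq_square using L LL(2) by (intro mult_left_mono K(1)) auto
    then have "norm (ws t - target t *\<^sub>R ubar) \<le> sqrt K * L"
      using K(1) L by (intro power2_le_imp_le[OF order_trans[OF d]]) simp_all
    then have "norm (ws t) \<le> sqrt K * L + target t"
      using norm_triangle_sub[of "ws t" "target t *\<^sub>R ubar"] s(2) by (simp add: norm_ubar)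
    also have "\<dots> = (sqrt K + 1 / (2 * \<gamma>)) * L" by (simp add: s(1) distrib_right)
    also have "\<dots> \<le> K' * L" using L K(1) by (intro mult_right_mono) (auto simp: K'_def)
    finally show ?thesis using 1 by (simp add: L_def)
  qed
  moreover have "K' \<ge> 0" using K(1) \<gamma>_pos by (simp add: K'_def)
  ultimately show ?thesis using that by blast
qed

text \<open>For large \<open>t\<close> the slack in \<open>margin_ws\<close> costs at most half of
  \<open>target t\<close>, leaving \<open>1 / (4 * \<gamma>)\<close> times the logarithm. The
  finitely many earlier times need only positivity.\<close>

lemma margin_ws_lower:
  obtains c where "c > 0" "\<And>t. t \<ge> 3 \<Longrightarrow> c * ln (real t) \<le> ubar \<bullet> ws t"
proof -
  note \<gamma>_pos = \<gamma>_pos[OF C_nonempty]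
  obtain c where c: "c \<ge> 0"
    "\<And>t. t \<ge> 2 \<Longrightarrow> target t - (2 / \<gamma> * ln (ln (real t)) + c) \<le> ubar \<bullet> ws t"
    by (rule margin_ws) blast
  have "eventually (\<lambda>t::nat. 2 * ln (ln (real t)) + \<gamma> * c \<le> ln (real t) / 4) sequentially"
    by (rule eventually_ln_ln_le)
  then obtain T where T: "\<And>t. t \<ge> T \<Longrightarrow> 2 * ln (ln (real t)) + \<gamma> * c \<le> ln (real t) / 4"
    unfolding eventually_sequentially by blast
  \<comment> \<open>The inserted eventual constant also keeps the set nonempty when there are no
    earlier times.\<close>
  define I where "I = insert (1 / (4 * \<gamma>)) ((\<lambda>t. (ubar \<bullet> ws t) / ln (real t)) ` {3..<T})"
  have fin: "finite I" "I \<noteq> {}" by (simp_all add: I_def)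
  have pos: "0 < ubar \<bullet> ws t" if "t \<ge> 3" for t
    using ubar_inner_iter_pos[OF C_nonempty, of \<eta>s "t - 1"] that by (simp del: iter.simps)
  have "Min I > 0"
    using fin pos ln_ge_1 \<gamma>_pos by (auto simp: I_def intro!: divide_pos_pos dest!: ln_ge_1)
  moreover have "Min I * ln (real t) \<le> ubar \<bullet> ws t" if t: "t \<ge> 3" for t
  proof (cases "t < T")
    case True
    then have "Min I \<le> (ubar \<bullet> ws t) / ln (real t)" using fin t by (intro Min_le) (auto simp: I_def)
    then show ?thesis using ln_ge_1[OF t] by (simp add: field_simps)
  next
    case False
    have "Min I * ln (real t) \<le> 1 / (4 * \<gamma>) * ln (real t)"
      using fin ln_ge_1[OF t] by (intro mult_right_mono Min_le) (auto simp: I_def)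
    also have "\<dots> \<le> target t - (2 / \<gamma> * ln (ln (real t)) + c)"
      using T[of t] False \<gamma>_pos by (simp add: target_def field_simps)
    also have "\<dots> \<le> ubar \<bullet> ws t" using c(2) t by simp
    finally show ?thesis .
  qed
  ultimately show ?thesis using that by blast
qed

end

end

section \<open>The matrix formulation\<close>

locale matrix_erm = linear_erm ell ell' ell'' "\<lambda>i. - (y $ i *\<^sub>R x $ i)"
  for ell ell' ell'' and x :: "real^'d^'n" and y :: "real^'n"
begin

lemma data_matrix_row: "row i (data_matrix x y) = - (y $ i *\<^sub>R x $ i)"
  by (simp add: row_def data_matrix_def vec_eq_iff)

lemma data_matrix_mult: "(data_matrix x y *v u) $ i = (- (y $ i *\<^sub>R x $ i)) \<bullet> u"
  by (simp add: matrix_vector_mul_component data_matrix_def)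

lemma idx_c_eq: "idx_c x y = C"
  unfolding idx_c_def C_def data_matrix_mult ..

lemma S_space_eq: "S_space x y = S"
  unfolding S_space_def S_def idx_S_def idx_c_eq data_matrix_row ..

lemma risk_eq: "risk ell x y = R"
  by (rule ext) (simp add: risk_def R_def inner_commute)

lemma gd_iter_eq: "gd_iter ell x y \<eta> t = iter \<eta> t"
  by (induction t) (simp_all add: risk_eq gradient_eqI[OF GDERIV_R])

lemma is_v_bar_iff: "is_v_bar ell x y v \<longleftrightarrow> v = vbar"
proof -
  have "is_v_bar ell x y v \<longleftrightarrow> v \<in> S \<and> (\<forall>u\<in>S. LS v \<le> LS u)"
    unfolding is_v_bar_def is_arg_min_linorder S_space_eq total_loss_def data_matrix_mult idx_S_def idx_c_eq
    by (auto simp: LS_def)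
  then show ?thesis using vbar_unique vbar_in vbar_min by blast
qed

lemma v_bar_eq: "v_bar ell x y = vbar"
  by (simp add: v_bar_def is_v_bar_iff)

lemma A_perp_mult: "(A_perp x y *v u) $ i = perp i \<bullet> u"
  by (simp add: matrix_vector_mul_component A_perp_def S_space_eq data_matrix_row
      orth_proj_orthogonal_comp subspace_S perp_def)

text \<open>The optimal value is \<open>- \<gamma>\<close>: \<open>ubar\<close> attains it, and
  \<open>perp_ge\<close> with Cauchy-Schwarz shows that no unit vector does better.\<close>

lemma is_u_bar_iff:
  assumes "C \<noteq> {}"
  shows "is_u_bar x y u \<longleftrightarrow> u = ubar"
proof -
  let ?M = "\<lambda>u. Max ((\<lambda>i. perp i \<bullet> u) ` C)"
  have M_le: "?M u \<le> b \<longleftrightarrow> (\<forall>i\<in>C. perp i \<bullet> u \<le> b)" for u b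
    using assms by (subst Max_le_iff) auto
  have ubar: "norm ubar = 1" "?M ubar \<le> - \<gamma>"
    using norm_ubar[OF assms] perp_ubar[OF assms] by (auto simp: M_le)
  have lower: "- \<gamma> \<le> ?M v" if "norm v = 1" for v
  proof -
    obtain i where i: "i \<in> C" "- \<gamma> * (ubar \<bullet> v) \<le> perp i \<bullet> v" using perp_ge[OF assms] by blast
    have "ubar \<bullet> v \<le> 1" using norm_cauchy_schwarz[of ubar v] ubar(1) that by simp
    then have "\<gamma> * (ubar \<bullet> v) \<le> \<gamma> * 1" using \<gamma>_pos[OF assms] by (intro mult_left_mono) auto
    then have "- \<gamma> \<le> perp i \<bullet> v" using i(2) by simp
    also have "\<dots> \<le> ?M v" using i(1) by (intro Max_ge) auto
    finally show ?thesis .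
  qed
  have "is_u_bar x y u \<longleftrightarrow> norm u = 1 \<and> (\<forall>v. norm v = 1 \<longrightarrow> ?M u \<le> ?M v)"
    unfolding is_u_bar_def is_arg_min_linorder A_perp_mult idx_c_eq ..
  also have "\<dots> \<longleftrightarrow> u = ubar"
  proof
    assume u: "norm u = 1 \<and> (\<forall>v. norm v = 1 \<longrightarrow> ?M u \<le> ?M v)"
    then have "?M u \<le> - \<gamma>" using ubar order_trans by blast
    then show "u = ubar" using ubar_unique[OF assms] u by (simp add: M_le)
  qed (use ubar lower order_trans in blast)
  finally show ?thesis .
qed

lemma u_bar_eq: "C \<noteq> {} \<Longrightarrow> u_bar x y = ubar"
  by (simp add: u_bar_def is_u_bar_iff)

lemma is_w_bar_iff: "is_w_bar ell x y r w \<longleftrightarrow> norm w \<le> r \<and> (\<forall>v. norm v \<le> r \<longrightarrow> R w \<le> R v)"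
  unfolding is_w_bar_def is_arg_min_linorder risk_eq ..

lemma w_bar_exists:
  assumes "r \<ge> 0"
  shows "\<exists>w. is_w_bar ell x y r w"
  using continuous_attains_inf[of "cball 0 r" R] assms R_continuous by (force simp: is_w_bar_iff)

lemma risk_gap_eq: "risk ell x y (gd_iter ell x y \<eta> t) - (INF w. risk ell x y w) = excess (iter \<eta> t)"
  unfolding risk_eq gd_iter_eq Inf_R excess_def ..

section \<open>Risk rates in the original notation\<close>

lemma gd_risk:
  "\<exists>K. \<forall>\<eta>. (\<forall>j. 0 < \<eta> j \<and> \<eta> j \<le> 1) \<longrightarrow>
    (\<forall>t\<ge>1. risk ell x y (gd_iter ell x y \<eta> t) - (INF w. risk ell x y w)
      \<le> K * (1 / real t + (ln (real t))\<^sup>2 / (\<Sum>j<t. \<eta> j)))"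
proof -
  obtain K where "\<And>\<eta> t. \<lbrakk>\<And>j. 0 < \<eta> j; \<And>j. \<eta> j \<le> 1; t \<ge> 1\<rbrakk> \<Longrightarrow>
       excess (iter \<eta> t) \<le> K * (1 / real t + (ln (real t))\<^sup>2 / (\<Sum>j<t. \<eta> j))"
    by (rule risk_rate) blast
  then show ?thesis unfolding risk_gap_eq by blast
qed

lemma gd_risk_step_sums:
  fixes h :: "nat \<Rightarrow> real"
  assumes "q > 0" and h: "\<And>t. t \<ge> 2 \<Longrightarrow> 0 < h t \<and> h t \<le> real t"
    and step: "\<And>\<eta> t. \<lbrakk>\<And>j. 0 < \<eta> j; P \<eta>; t \<ge> T\<rbrakk> \<Longrightarrow> q * h t \<le> (\<Sum>j<t. \<eta> j)"
  shows "\<exists>K. \<forall>\<eta>. (\<forall>j. 0 < \<eta> j \<and> \<eta> j \<le> 1) \<and> P \<eta> \<longrightarrow>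
    (\<forall>t\<ge>2. risk ell x y (gd_iter ell x y \<eta> t) - (INF w. risk ell x y w)
      \<le> K * ((ln (real t))\<^sup>2 / h t))"
proof -
  obtain K where
    "\<And>\<eta> t. \<lbrakk>\<And>j. 0 < \<eta> j; \<And>j. \<eta> j \<le> 1; t \<ge> 2; t \<ge> T \<Longrightarrow> q * h t \<le> (\<Sum>j<t. \<eta> j)\<rbrakk> \<Longrightarrow>
       excess (iter \<eta> t) \<le> K * ((ln (real t))\<^sup>2 / h t)"
    by (rule risk_rate_step_sums[OF assms(1) h, of T]) blast+
  then show ?thesis unfolding risk_gap_eq using step by blast
qed

lemma gd_risk_constant_steps:
  assumes "c > 0"
  shows "\<exists>K. \<forall>\<eta>. (\<forall>j. 0 < \<eta> j \<and> \<eta> j \<le> 1) \<and> (\<forall>j\<ge>J. c \<le> \<eta> j) \<longrightarrow>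
    (\<forall>t\<ge>2. risk ell x y (gd_iter ell x y \<eta> t) - (INF w. risk ell x y w)
      \<le> K * ((ln (real t))\<^sup>2 / real t))"
proof (rule gd_risk_step_sums[where q = "c / 2" and T = "2 * J"])
  fix \<eta> :: "nat \<Rightarrow> real" and t
  assume \<eta>: "\<And>j. 0 < \<eta> j" "\<forall>j\<ge>J. c \<le> \<eta> j" and t: "2 * J \<le> t"
  \<comment> \<open>The first \<open>J\<close> steps are dropped; for \<open>t \<ge> 2 * J\<close>
    at least half of the steps remain.\<close>
  have "c / 2 * real t \<le> c * real (t - J)" using assms t by (simp add: of_nat_diff field_simps)
  also have "\<dots> = (\<Sum>j=J..<t. c)" by simp
  also have "\<dots> \<le> (\<Sum>j=J..<t. \<eta> j)" using \<eta>(2) by (intro sum_mono) auto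
  also have "\<dots> \<le> (\<Sum>j<t. \<eta> j)" using \<eta>(1) by (intro sum_mono2) (auto simp: less_imp_le)
  finally show "c / 2 * real t \<le> (\<Sum>j<t. \<eta> j)" .
qed (use assms in auto)

lemma gd_risk_sqrt_steps:
  assumes "c > 0"
  shows "\<exists>K. \<forall>\<eta>. (\<forall>j. 0 < \<eta> j \<and> \<eta> j \<le> 1) \<and> (\<forall>j\<ge>J. c / sqrt (real j + 1) \<le> \<eta> j) \<longrightarrow>
    (\<forall>t\<ge>2. risk ell x y (gd_iter ell x y \<eta> t) - (INF w. risk ell x y w)
      \<le> K * ((ln (real t))\<^sup>2 / sqrt (real t)))"
proof (rule gd_risk_step_sums[where q = "c / 2" and T = "2 * J"])
  fix \<eta> :: "nat \<Rightarrow> real" and t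
  assume \<eta>: "\<And>j. 0 < \<eta> j" "\<forall>j\<ge>J. c / sqrt (real j + 1) \<le> \<eta> j" and t: "2 * J \<le> t"
  \<comment> \<open>At least half of the steps come after \<open>J\<close>, and each of those is at
    least \<open>c / sqrt t\<close>.\<close>
  have "c / 2 * sqrt (real t) = c / 2 * (real t / sqrt (real t))" by (simp add: real_div_sqrt)
  also have "\<dots> = (c / sqrt (real t)) * (real t / 2)" by simp
  also have "\<dots> \<le> (c / sqrt (real t)) * real (t - J)"
    using assms t by (intro mult_left_mono) (auto simp: of_nat_diff)
  also have "\<dots> = (\<Sum>j=J..<t. c / sqrt (real t))" by simp
  also have "\<dots> \<le> (\<Sum>j=J..<t. \<eta> j)"
  proof (rule sum_mono)
    fix j assume j: "j \<in> {J..<t}"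
    have "c / sqrt (real t) \<le> c / sqrt (real j + 1)"
      using j assms by (intro divide_left_mono) auto
    also have "\<dots> \<le> \<eta> j" using j \<eta>(2) by simp
    finally show "c / sqrt (real t) \<le> \<eta> j" .
  qed
  also have "\<dots> \<le> (\<Sum>j<t. \<eta> j)" using \<eta>(1) by (intro sum_mono2) (auto simp: less_imp_le)
  finally show "c / 2 * sqrt (real t) \<le> (\<Sum>j<t. \<eta> j)" .
next
  show "0 < sqrt (real t) \<and> sqrt (real t) \<le> real t" if "t \<ge> 2" for t
    using that by (auto intro!: real_le_lsqrt self_le_power)
qed (use assms in simp)

section \<open>Conclusions for the projections and the direction\<close>

lemma proj_rate:
  "\<exists>K. \<forall>t\<ge>2. norm (orth_proj S (ws t)) \<le> K
    \<and> (\<forall>wb. is_w_bar ell x y (norm (ws t)) wb \<longrightarrow>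
         max ((norm (orth_proj S (ws t) - vbar))\<^sup>2) ((norm (orth_proj S wb - vbar))\<^sup>2)
           \<le> K * ((ln (real t))\<^sup>2 / sqrt (real t)))"
proof -
  obtain K where K: "K \<ge> 0" "\<And>t v. \<lbrakk>t \<ge> 2; R v \<le> R (ws t)\<rbrakk> \<Longrightarrow>
      (norm (orth_proj S v - vbar))\<^sup>2 \<le> K * ((ln (real t))\<^sup>2 / sqrt (real t))"
    by (rule proj_ws_rate) blast
  obtain B where B: "B \<ge> 0" "\<And>v. \<lbrakk>v \<in> S; LS v \<le> real CARD('n)\<rbrakk> \<Longrightarrow> norm v \<le> B"
    by (rule LS_coercive) blast
  have "norm (orth_proj S (ws t)) \<le> B" for t
    using B(2)[OF orth_proj_in[OF subspace_S]] LS_le_N[OF R_ws_le_1] by (simp add: LS_orth_proj)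
  then have 1: "norm (orth_proj S (ws t)) \<le> K + B" for t using K(1) by (rule add_increasing[rotated])
  have 2: "(norm (orth_proj S v - vbar))\<^sup>2 \<le> (K + B) * ((ln (real t))\<^sup>2 / sqrt (real t))"
    if "t \<ge> 2" "R v \<le> R (ws t)" for t v
    using B(1) by (intro order_trans[OF K(2)[OF that]] mult_right_mono) auto
  show ?thesis
    by (rule exI[of _ "K + B"]) (simp add: is_w_bar_iff 1 2 del: times_divide_eq_right)
qed

lemma proj_tendsto: "(\<lambda>t. orth_proj S (ws t)) \<longlonglongrightarrow> vbar"
proof -
  obtain K where K: "K \<ge> 0" "\<And>t v. \<lbrakk>t \<ge> 2; R v \<le> R (ws t)\<rbrakk> \<Longrightarrow>
      (norm (orth_proj S v - vbar))\<^sup>2 \<le> K * ((ln (real t))\<^sup>2 / sqrt (real t))"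
    by (rule proj_ws_rate) blast
  have "(\<lambda>t. (norm (orth_proj S (ws t) - vbar))\<^sup>2) \<longlonglongrightarrow> 0"
  proof (rule tendsto_sandwich[where f = "\<lambda>_. 0"])
    show "(\<lambda>t::nat. K * ((ln (real t))\<^sup>2 / sqrt (real t))) \<longlonglongrightarrow> 0"
      by (rule tendsto_mult_right_zero) real_asymp
    show "\<forall>\<^sub>F t in sequentially. (norm (orth_proj S (ws t) - vbar))\<^sup>2 \<le> K * ((ln (real t))\<^sup>2 / sqrt (real t))"
      using K(2) by (intro eventually_sequentiallyI[of 2]) blast
  qed auto
  then show ?thesis by (simp add: tendsto_norm_zero_iff LIM_zero_iff)
qed

lemma proj_lower:
  assumes "vbar \<noteq> 0"
  shows "\<exists>\<kappa>>0. \<exists>c>0. \<forall>t\<ge>2. \<kappa> * (real CARD('n) * ln (real t)) \<le> (real t)\<^sup>2 \<longrightarrow> c \<le> norm (orth_proj S (ws t))"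
proof -
  have "(\<lambda>t. norm (orth_proj S (ws t))) \<longlonglongrightarrow> norm vbar" by (rule tendsto_norm[OF proj_tendsto])
  then have "\<forall>\<^sub>F t in sequentially. norm vbar / 2 < norm (orth_proj S (ws t))"
    by (rule order_tendstoD) (use assms in simp)
  then obtain T where T: "\<And>t. t \<ge> T \<Longrightarrow> norm vbar / 2 < norm (orth_proj S (ws t))"
    unfolding eventually_sequentially by blast
  \<comment> \<open>Since \<open>CARD('n) \<ge> 1\<close> and \<open>ln t \<ge> ln 2\<close>, the
    size condition with this constant forces \<open>t > T\<close>.\<close>
  define \<kappa> where "\<kappa> = ((real T)\<^sup>2 + 1) / ln 2"
  have "\<kappa> > 0" by (simp add: \<kappa>_def add_nonneg_pos)
  moreover have "norm vbar / 2 \<le> norm (orth_proj S (ws t))"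
    if t: "t \<ge> 2" and le: "\<kappa> * (real CARD('n) * ln (real t)) \<le> (real t)\<^sup>2" for t
  proof -
    have "(real T)\<^sup>2 < \<kappa> * (1 * ln 2)" by (simp add: \<kappa>_def)
    also have "\<dots> \<le> \<kappa> * (real CARD('n) * ln (real t))"
      using \<open>\<kappa> > 0\<close> t by (intro mult_left_mono mult_mono) (auto simp: Suc_leI)
    also have "\<dots> \<le> (real t)\<^sup>2" by (rule le)
    finally have "real T < real t" by (rule power2_less_imp_less) simp
    then show ?thesis using T by (simp add: less_imp_le)
  qed
  ultimately show ?thesis using assms by (intro exI[of _ \<kappa>] exI[of _ "norm vbar / 2"] conjI) auto
qed

context
  assumes C_nonempty: "C \<noteq> {}"
begin

lemma ubar_inner_le_norm_perp: "ubar \<bullet> w \<le> norm (w - orth_proj S w)"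
proof -
  have "orth_proj S w \<bullet> ubar = 0"
    using inner_orthogonal_comp[OF orth_proj_in[OF subspace_S] ubar_in[OF C_nonempty]] .
  then have "ubar \<bullet> w = ubar \<bullet> (w - orth_proj S w)"
    by (simp add: inner_diff_right inner_commute)
  also have "\<dots> \<le> norm (w - orth_proj S w)"
    using norm_cauchy_schwarz[of ubar "w - orth_proj S w"] norm_ubar[OF C_nonempty] by simp
  finally show ?thesis .
qed

lemma norm_perp_le: "norm (w - orth_proj S w) \<le> norm w"
proof -
  have "orth_proj S w \<bullet> (w - orth_proj S w) = 0"
    by (intro inner_orthogonal_comp[of _ S] orth_proj_in diff_orth_proj_in subspace_S)
  then have "norm (w - orth_proj S w) * norm (w - orth_proj S w) = w \<bullet> (w - orth_proj S w)"
    unfolding power2_eq_square[symmetric] power2_norm_eq_inner inner_diff_left[of w] by simp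
  also have "\<dots> \<le> norm w * norm (w - orth_proj S w)" by (rule norm_cauchy_schwarz)
  finally show ?thesis by (cases "w - orth_proj S w = 0") (simp_all del: right_minus_eq)
qed

text \<open>The \<open>ubar\<close> component bounds the projection onto the complement from below.
  The same bound shows that the radius \<open>norm (ws t)\<close> grows logarithmically, which feeds
  \<open>constrained_direction\<close>.\<close>

lemma direction_rate:
  "\<exists>c>0. \<exists>K. \<forall>t\<ge>3. c * ln (real t) \<le> norm (ws t - orth_proj S (ws t))
    \<and> norm (ws t - orth_proj S (ws t)) \<le> K * ln (real t)
    \<and> (\<forall>wb. is_w_bar ell x y (norm (ws t)) wb \<longrightarrow>
         max ((norm (ws t /\<^sub>R norm (ws t) - ubar))\<^sup>2) ((norm (wb /\<^sub>R norm wb - ubar))\<^sup>2)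
           \<le> K * (ln (ln (real t)) / ln (real t)))"
proof -
  obtain K where K: "K \<ge> 0"
    "\<And>t. t \<ge> 3 \<Longrightarrow> (norm (ws t /\<^sub>R norm (ws t) - ubar))\<^sup>2 \<le> K * (ln (ln (real t)) / ln (real t))"
    "\<And>t. t \<ge> 3 \<Longrightarrow> norm (ws t) \<le> K * ln (real t)"
    by (rule direction_ws_rate[OF C_nonempty]) blast
  obtain c where c: "c > 0" "\<And>t. t \<ge> 3 \<Longrightarrow> c * ln (real t) \<le> ubar \<bullet> ws t"
    by (rule margin_ws_lower[OF C_nonempty]) blast
  obtain M where M: "M \<ge> 0"
    "\<And>r w. \<lbrakk>r > 0; norm w \<le> r; \<And>v. norm v \<le> r \<Longrightarrow> R w \<le> R v\<rbrakk> \<Longrightarrow>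
      (norm (w /\<^sub>R norm w - ubar))\<^sup>2 \<le> M / r"
    by (rule constrained_direction[OF C_nonempty]) blast
  define q where "q = ln (ln (3::real))"
  have q: "q > 0" unfolding q_def by (rule ln_ln_3_pos)
  define K' where "K' = K + M / (c * q)"
  have M0: "M / (c * q) \<ge> 0" using M(1) c(1) q by simp
  have "c * ln (real t) \<le> norm (ws t - orth_proj S (ws t))
    \<and> norm (ws t - orth_proj S (ws t)) \<le> K' * ln (real t)
    \<and> (\<forall>wb. is_w_bar ell x y (norm (ws t)) wb \<longrightarrow>
         max ((norm (ws t /\<^sub>R norm (ws t) - ubar))\<^sup>2) ((norm (wb /\<^sub>R norm wb - ubar))\<^sup>2)
           \<le> K' * (ln (ln (real t)) / ln (real t)))" if t: "t \<ge> 3" for t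
  proof -
    define L where "L = ln (real t)"
    have L: "1 < L" unfolding L_def by (rule ln_ge_1[OF t])
    have LL: "q \<le> ln L" unfolding L_def q_def by (rule ln_ln_ge[OF t])
    have lower: "c * L \<le> norm (ws t - orth_proj S (ws t))"
      using c(2)[OF t] ubar_inner_le_norm_perp order_trans unfolding L_def by blast
    have "norm (ws t) \<le> K * L" using K(3)[OF t] by (simp add: L_def)
    also have "\<dots> \<le> K' * L" using L M0 by (intro mult_right_mono) (auto simp: K'_def)
    finally have upper: "norm (ws t - orth_proj S (ws t)) \<le> K' * L"
      using norm_perp_le order_trans by blast
    have r: "c * L \<le> norm (ws t)" using lower norm_perp_le order_trans by blast
    have cL: "0 < c * L" using c(1) L by simp
    have "(norm (ws t /\<^sub>R norm (ws t) - ubar))\<^sup>2 \<le> K * (ln L / L)" using K(2)[OF t] by (simp add: L_def)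
    also have "\<dots> \<le> K' * (ln L / L)"
      using L q LL M0 by (intro mult_right_mono) (auto simp: K'_def)
    finally have iterate: "(norm (ws t /\<^sub>R norm (ws t) - ubar))\<^sup>2 \<le> K' * (ln L / L)" .
    have constrained: "(norm (wb /\<^sub>R norm wb - ubar))\<^sup>2 \<le> K' * (ln L / L)"
      if "is_w_bar ell x y (norm (ws t)) wb" for wb
    proof -
      have "(norm (wb /\<^sub>R norm wb - ubar))\<^sup>2 \<le> M / norm (ws t)"
        by (rule M(2)) (use that r cL in \<open>auto simp: is_w_bar_iff simp del: zero_less_norm_iff\<close>)
      also have "\<dots> \<le> M / (c * L)"
        using mult_pos_pos[OF less_le_trans[OF cL r] cL] by (intro divide_left_mono r M(1))
      \<comment> \<open>\<open>q \<le> ln L\<close> trades the stronger rate 1/L for the common rate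
        \<open>ln L / L\<close>.\<close>
      also have "\<dots> = M / (c * q) * (q / L)" using q by simp
      also have "\<dots> \<le> M / (c * q) * (ln L / L)"
        using LL L M0 by (intro mult_left_mono divide_right_mono) auto
      also have "\<dots> \<le> K' * (ln L / L)"
        using L q LL K(1) by (intro mult_right_mono) (auto simp: K'_def)
      finally show ?thesis .
    qed
    show ?thesis using lower upper iterate constrained by (simp add: L_def)
  qed
  then show ?thesis using c(1) by blast
qed

lemma direction_tendsto: "(\<lambda>t. ws t /\<^sub>R norm (ws t)) \<longlonglongrightarrow> ubar"
proof -
  obtain K where K:
    "\<And>t. t \<ge> 3 \<Longrightarrow> (norm (ws t /\<^sub>R norm (ws t) - ubar))\<^sup>2 \<le> K * (ln (ln (real t)) / ln (real t))"
    by (rule direction_ws_rate[OF C_nonempty]) blast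
  have "(\<lambda>t. (norm (ws t /\<^sub>R norm (ws t) - ubar))\<^sup>2) \<longlonglongrightarrow> 0"
  proof (rule tendsto_sandwich[where f = "\<lambda>_. 0"])
    show "(\<lambda>t::nat. K * (ln (ln (real t)) / ln (real t))) \<longlonglongrightarrow> 0"
      by (rule tendsto_mult_right_zero) real_asymp
    show "\<forall>\<^sub>F t in sequentially. (norm (ws t /\<^sub>R norm (ws t) - ubar))\<^sup>2 \<le> K * (ln (ln (real t)) / ln (real t))"
      using K by (intro eventually_sequentiallyI[of 3]) blast
  qed auto
  then show ?thesis by (simp add: tendsto_norm_zero_iff LIM_zero_iff)
qed

end

end

text \<open>In the risk part the constants precede \<eta>, so they depend on the data and on the
  lower bound for the steps only; \<open>J\<close> renders the asymptotic lower bound on the steps.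
  The times start at 2 or 3 where ln t or ln ln t must be positive. The lower half of the order-one
  claim is for \<open>vbar \<noteq> 0\<close>, because the projections converge to
  \<open>vbar\<close>.\<close>

theorem theorem1p1:
  fixes x :: "real^'d^'n" and y :: "real^'n" and ell :: "real \<Rightarrow> real"
  assumes "ell \<in> {ell_log, ell_exp}"
    and "\<And>i. norm (y $ i *\<^sub>R x $ i) \<le> 1"
  shows
    \<comment> \<open>convergence in risk\<close>
    "(\<exists>C. \<forall>\<eta>. (\<forall>j. 0 < \<eta> j \<and> \<eta> j \<le> 1) \<longrightarrow>
        (\<forall>t\<ge>1. risk ell x y (gd_iter ell x y \<eta> t) - (INF w. risk ell x y w)
               \<le> C * (1 / real t + (ln (real t))\<^sup>2 / (\<Sum>j<t. \<eta> j))))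
   \<and> (\<forall>c>0. \<forall>J. \<exists>C. \<forall>\<eta>. (\<forall>j. 0 < \<eta> j \<and> \<eta> j \<le> 1) \<and> (\<forall>j\<ge>J. c \<le> \<eta> j) \<longrightarrow>
        (\<forall>t\<ge>2. risk ell x y (gd_iter ell x y \<eta> t) - (INF w. risk ell x y w)
               \<le> C * ((ln (real t))\<^sup>2 / real t)))
   \<and> (\<forall>c>0. \<forall>J. \<exists>C. \<forall>\<eta>. (\<forall>j. 0 < \<eta> j \<and> \<eta> j \<le> 1) \<and> (\<forall>j\<ge>J. c / sqrt (real j + 1) \<le> \<eta> j) \<longrightarrow>
        (\<forall>t\<ge>2. risk ell x y (gd_iter ell x y \<eta> t) - (INF w. risk ell x y w)
               \<le> C * ((ln (real t))\<^sup>2 / sqrt (real t))))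
   \<and> \<comment> \<open>convergence in parameters\<close>
    (let S = S_space x y; vbar = v_bar ell x y; ubar = u_bar x y; n = CARD('n);
         w = gd_iter ell x y (\<lambda>j. 1 / sqrt (real j + 1))
     in (\<exists>!v. is_v_bar ell x y v)
      \<and> (\<forall>t. \<exists>wb. is_w_bar ell x y (norm (w t)) wb)
      \<and> (\<forall>\<kappa>>0. \<exists>C. \<forall>t\<ge>2. \<kappa> * (real n * ln (real t)) \<le> (real t)\<^sup>2 \<longrightarrow>
            norm (orth_proj S (w t)) \<le> C
          \<and> (\<forall>wb. is_w_bar ell x y (norm (w t)) wb \<longrightarrow>
               max ((norm (orth_proj S (w t) - vbar))\<^sup>2) ((norm (orth_proj S wb - vbar))\<^sup>2)
                 \<le> C * ((ln (real t))\<^sup>2 / sqrt (real t))))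
      \<and> (vbar \<noteq> 0 \<longrightarrow>
           (\<exists>\<kappa>>0. \<exists>c>0. \<forall>t\<ge>2. \<kappa> * (real n * ln (real t)) \<le> (real t)\<^sup>2 \<longrightarrow>
              c \<le> norm (orth_proj S (w t))))
      \<and> (\<lambda>t. orth_proj S (w t)) \<longlonglongrightarrow> vbar
      \<and> (idx_c x y \<noteq> {} \<longrightarrow>
            (\<exists>u. \<forall>i\<in>idx_c x y. (A_perp x y *v u) $ i < 0)
          \<and> (\<exists>!u. is_u_bar x y u)
          \<and> ubar \<in> S\<^sup>\<bottom>
          \<and> (\<forall>\<kappa>>0. \<exists>c>0. \<exists>C. \<forall>t\<ge>3. \<kappa> * (real n * ln (real t)) \<le> (real t)\<^sup>2 \<longrightarrow>
                c * ln (real t) \<le> norm (orth_proj (S\<^sup>\<bottom>) (w t))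
              \<and> norm (orth_proj (S\<^sup>\<bottom>) (w t)) \<le> C * ln (real t)
              \<and> (\<forall>wb. is_w_bar ell x y (norm (w t)) wb \<longrightarrow>
                   max ((norm (w t /\<^sub>R norm (w t) - ubar))\<^sup>2) ((norm (wb /\<^sub>R norm wb - ubar))\<^sup>2)
                     \<le> C * (ln (ln (real t)) / ln (real t))))
          \<and> (\<lambda>t. w t /\<^sub>R norm (w t)) \<longlonglongrightarrow> ubar))"
proof -
  obtain ell' ell'' where "convex_loss ell ell' ell''"
    using assms(1) convex_loss_exp convex_loss_log by blast
  then interpret matrix_erm ell ell' ell'' x y
    using assms(2) by (simp add: matrix_erm_def linear_erm_def linear_erm_axioms_def)
  show ?thesis
    unfolding Let_def S_space_eq v_bar_eq is_v_bar_iff idx_c_eq A_perp_mult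
      orth_proj_orthogonal_comp[OF subspace_S] gd_iter_eq[of "\<lambda>j. 1 / sqrt (real j + 1)"]
  proof (intro conjI)
    show "C \<noteq> {} \<longrightarrow>
        (\<exists>u. \<forall>i\<in>C. perp i \<bullet> u < 0)
      \<and> (\<exists>!u. is_u_bar x y u)
      \<and> u_bar x y \<in> S\<^sup>\<bottom>
      \<and> (\<forall>\<kappa>>0. \<exists>c>0. \<exists>C. \<forall>t\<ge>3. \<kappa> * (real CARD('n) * ln (real t)) \<le> (real t)\<^sup>2 \<longrightarrow>
            c * ln (real t) \<le> norm (ws t - orth_proj S (ws t))
          \<and> norm (ws t - orth_proj S (ws t)) \<le> C * ln (real t)
          \<and> (\<forall>wb. is_w_bar ell x y (norm (ws t)) wb \<longrightarrow>
               max ((norm (ws t /\<^sub>R norm (ws t) - u_bar x y))\<^sup>2) ((norm (wb /\<^sub>R norm wb - u_bar x y))\<^sup>2)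
                 \<le> C * (ln (ln (real t)) / ln (real t))))
      \<and> (\<lambda>t. ws t /\<^sub>R norm (ws t)) \<longlonglongrightarrow> u_bar x y"
    proof
      assume C: "C \<noteq> {}"
      have "\<exists>u. \<forall>i\<in>C. perp i \<bullet> u < 0"
      proof -
        obtain u where u: "\<And>i. i \<in> C \<Longrightarrow> perp i \<bullet> u \<le> -1" by (rule perp_separable) blast
        show ?thesis by (rule exI[of _ u]) (use u in force)
      qed
      then show "(\<exists>u. \<forall>i\<in>C. perp i \<bullet> u < 0)
        \<and> (\<exists>!u. is_u_bar x y u)
        \<and> u_bar x y \<in> S\<^sup>\<bottom>
        \<and> (\<forall>\<kappa>>0. \<exists>c>0. \<exists>C. \<forall>t\<ge>3. \<kappa> * (real CARD('n) * ln (real t)) \<le> (real t)\<^sup>2 \<longrightarrow>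
              c * ln (real t) \<le> norm (ws t - orth_proj S (ws t))
            \<and> norm (ws t - orth_proj S (ws t)) \<le> C * ln (real t)
            \<and> (\<forall>wb. is_w_bar ell x y (norm (ws t)) wb \<longrightarrow>
                 max ((norm (ws t /\<^sub>R norm (ws t) - u_bar x y))\<^sup>2) ((norm (wb /\<^sub>R norm wb - u_bar x y))\<^sup>2)
                   \<le> C * (ln (ln (real t)) / ln (real t))))
        \<and> (\<lambda>t. ws t /\<^sub>R norm (ws t)) \<longlonglongrightarrow> u_bar x y"
        unfolding u_bar_eq[OF C] is_u_bar_iff[OF C]
        using ubar_in[OF C] direction_rate[OF C] direction_tendsto[OF C] by blast
    qed
    show "\<exists>!v. v = vbar" by simp
    show "\<forall>t. \<exists>wb. is_w_bar ell x y (norm (ws t)) wb" using w_bar_exists by simp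
    obtain K where K: "\<forall>t\<ge>2. norm (orth_proj S (ws t)) \<le> K
        \<and> (\<forall>wb. is_w_bar ell x y (norm (ws t)) wb \<longrightarrow>
             max ((norm (orth_proj S (ws t) - vbar))\<^sup>2) ((norm (orth_proj S wb - vbar))\<^sup>2)
               \<le> K * ((ln (real t))\<^sup>2 / sqrt (real t)))"
      using proj_rate by blast
    show "\<forall>\<kappa>>0. \<exists>K. \<forall>t\<ge>2. \<kappa> * (real CARD('n) * ln (real t)) \<le> (real t)\<^sup>2 \<longrightarrow>
        norm (orth_proj S (ws t)) \<le> K
        \<and> (\<forall>wb. is_w_bar ell x y (norm (ws t)) wb \<longrightarrow>
             max ((norm (orth_proj S (ws t) - vbar))\<^sup>2) ((norm (orth_proj S wb - vbar))\<^sup>2)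
               \<le> K * ((ln (real t))\<^sup>2 / sqrt (real t)))"
      by (intro allI impI exI[of _ K] K[rule_format, THEN conjunct1] K[rule_format, THEN conjunct2] conjI)
  qed (rule gd_risk proj_tendsto impI[OF proj_lower] allI impI gd_risk_constant_steps
      gd_risk_sqrt_steps | assumption)+
qed

end
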